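(* Let $\bar\beta>0$ be the minimum of $\beta_0$ over $[c^{cj},+\infty)$, i.e. the $\beta$-coordinate of a turning point $(\bar\beta,\bar c)$. Then for every $\beta\in(0,\bar\beta)$ there is a continuum of admissible speeds $\{c\ge c^{cj}\}$: for every $c\ge c^{cj}$ there is a reactive traveling wave solution of speed $c$ with viscosity $\beta$.
   Context: Fix real numbers $q_0>0$, $K>0$, $0\le\alpha<1$ and $T_i$ with $0<T_i<\sqrt{2q_0}$. The function $\varphi:[0,\infty)\to[0,\infty)$ vanishes on $[0,T_i)$ and is $C^\infty$ and positive on $[T_i,\infty)$ (hence discontinuous at $T_i$); moreover $\psi(V)=\varphi(1/V)$ extends smoothly to $V=0$ with $\psi(0)>0$. Notation: $c^{cj}=\sqrt{2q_0}$, and for $c\ge c^{cj}$, $T_0(c)=c+\sqrt{c^2-2q_0}$, $T_1(c)=c-\sqrt{c^2-2q_0}$. For $\beta>0$ and $c\ge c^{cj}$, a solution (reactive traveling wave of speed $c$ with viscosity $\beta$) is a pair $(T,Z)\in C^1(\mathbb R)\times C^0(\mathbb R)$ for which there is $\ell\in(0,\infty)$ with: - $T(0)=T_i$, $T(\xi)<T_i$ for $\xi>0$, $T(\xi)>T_i$ for $\xi<0$; - for $\xi>0$: $Z\equiv1$, $\beta T_\xi=-cT+\frac{T^2}{2}$, and $T(\xi)\to0$ as $\xi\to+\infty$; - for $-\ell<\xi<0$ (reaction zone): $Z>0$, $\beta T_\xi=-cT+\frac{T^2}2+q_0(1-Z)$, $Z_\xi=K\varphi(T)Z^\alpha$, with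 $Z(0)=1$ and $Z(-\ell)=0$; - for $\xi<-\ell$: $Z\equiv0$, $\beta T_\xi=-cT+\frac{T^2}2+q_0$, and $T(\xi)$ has a finite limit $T_-$ as $\xi\to-\infty$ (necessarily $T_-\in\{T_0(c),T_1(c)\}$). For $c\in[c^{cj},\infty)$, $\beta_0(c)$ denotes the unique $\beta>0$ for which there is a solution of speed $c$ with $T\equiv T_0(c)$ on $\{\xi\le-\ell\}$. A turning point is a point $(\bar\beta,\bar c)$, $\bar c>c^{cj}$, with $\bar\beta=\beta_0(\bar c)$, $\beta_0'(\bar c)=0$ and $0<\bar\beta\le\beta_0(c)$ for all $c\ge c^{cj}$; such a point exists. *)

theory Defs
  imports "HOL-Analysis.Analysis"
begin

text \<open>
  Smoothness on a set containing boundary points: derivatives of all orders exist relative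
  to \<open>S\<close>, hence one-sidedly at the end points of an interval, and only the values of \<open>f\<close> on
  \<open>S\<close> matter.
\<close>

definition smooth_on :: "real set \<Rightarrow> (real \<Rightarrow> real) \<Rightarrow> bool" where
  "smooth_on S f \<longleftrightarrow>
     (\<exists>D :: nat \<Rightarrow> real \<Rightarrow> real. D 0 = f \<and>
        (\<forall>n. \<forall>x\<in>S. (D n has_real_derivative D (Suc n) x) (at x within S)))"

text \<open>
  The function \<open>\<phi>\<close> lives on \<open>[0,\<infinity>)\<close>; its values at negative arguments are irrelevant. As
  \<open>\<phi>\<close> jumps at \<open>Ti\<close>, the function \<open>V \<mapsto> \<phi>(1/V)\<close> is smooth up to \<open>V = 1/Ti\<close> only, which is
  where the smooth extension to \<open>V = 0\<close> is taken.
\<close>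

locale reactive_wave_model =
  fixes q0 K \<alpha> Ti :: real and \<phi> :: "real \<Rightarrow> real"
  assumes q0_pos: "0 < q0"
    and K_pos: "0 < K"
    and \<alpha>_nonneg: "0 \<le> \<alpha>" and \<alpha>_less_1: "\<alpha> < 1"
    and Ti_pos: "0 < Ti" and Ti_less: "Ti < sqrt (2 * q0)"
    and \<phi>_zero: "\<And>x. 0 \<le> x \<Longrightarrow> x < Ti \<Longrightarrow> \<phi> x = 0"
    and \<phi>_pos: "\<And>x. Ti \<le> x \<Longrightarrow> 0 < \<phi> x"
    and \<phi>_smooth: "smooth_on {Ti..} \<phi>"
    and \<psi>_extends: "\<exists>\<psi>. smooth_on {0..1 / Ti} \<psi> \<and>
          (\<forall>V. 0 < V \<and> V \<le> 1 / Ti \<longrightarrow> \<psi> V = \<phi> (1 / V)) \<and> 0 < \<psi> 0"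
begin

definition c_cj :: real where
  "c_cj = sqrt (2 * q0)"

definition T0 :: "real \<Rightarrow> real" where
  "T0 c = c + sqrt (c\<^sup>2 - 2 * q0)"

text \<open>
  A travelling wave of speed \<open>c\<close> with viscosity \<open>\<beta>\<close> whose reaction zone is \<open>(-l,0)\<close>.
  In the reaction zone \<open>Z > 0\<close>, so \<open>Z powr \<alpha>\<close> is the ordinary power (and is \<open>1\<close> for
  \<open>\<alpha> = 0\<close>).
\<close>

definition wave_profile ::
  "real \<Rightarrow> real \<Rightarrow> real \<Rightarrow> (real \<Rightarrow> real) \<Rightarrow> (real \<Rightarrow> real) \<Rightarrow> bool" where
  "wave_profile \<beta> c l T Z \<longleftrightarrow>
     0 < \<beta> \<and> c_cj \<le> c \<and> 0 < l \<and>
     T C1_differentiable_on UNIV \<and> continuous_on UNIV Z \<and>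
     T 0 = Ti \<and> (\<forall>\<xi>>0. T \<xi> < Ti) \<and> (\<forall>\<xi><0. Ti < T \<xi>) \<and>
     (\<forall>\<xi>>0. Z \<xi> = 1 \<and> \<beta> * deriv T \<xi> = - c * T \<xi> + (T \<xi>)\<^sup>2 / 2) \<and>
     (T \<longlongrightarrow> 0) at_top \<and>
     (\<forall>\<xi>. - l < \<xi> \<and> \<xi> < 0 \<longrightarrow>
        0 < Z \<xi> \<and>
        \<beta> * deriv T \<xi> = - c * T \<xi> + (T \<xi>)\<^sup>2 / 2 + q0 * (1 - Z \<xi>) \<and>
        (Z has_real_derivative K * \<phi> (T \<xi>) * Z \<xi> powr \<alpha>) (at \<xi>)) \<and>
     Z 0 = 1 \<and> Z (- l) = 0 \<and>
     (\<forall>\<xi>. \<xi> < - l \<longrightarrow>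
        Z \<xi> = 0 \<and> \<beta> * deriv T \<xi> = - c * T \<xi> + (T \<xi>)\<^sup>2 / 2 + q0) \<and>
     (\<exists>T_minus. (T \<longlongrightarrow> T_minus) at_bot)"

definition reactive_wave ::
  "real \<Rightarrow> real \<Rightarrow> (real \<Rightarrow> real) \<Rightarrow> (real \<Rightarrow> real) \<Rightarrow> bool" where
  "reactive_wave \<beta> c T Z \<longleftrightarrow> (\<exists>l. wave_profile \<beta> c l T Z)"

definition \<beta>0 :: "real \<Rightarrow> real" where
  "\<beta>0 c = (THE \<beta>. 0 < \<beta> \<and>
     (\<exists>l T Z. wave_profile \<beta> c l T Z \<and> (\<forall>\<xi>\<le>- l. T \<xi> = T0 c)))"

definition turning_point :: "real \<Rightarrow> real \<Rightarrow> bool" where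
  "turning_point \<beta>b cb \<longleftrightarrow>
     c_cj < cb \<and> \<beta>b = \<beta>0 cb \<and> (\<beta>0 has_real_derivative 0) (at cb) \<and>
     0 < \<beta>b \<and> (\<forall>c\<ge>c_cj. \<beta>b \<le> \<beta>0 c)"

end

end

theory Submission
  imports Defs
begin

text \<open>
  Fix a speed \<open>c\<close>. Across the reaction zone \<open>Z\<close> is strictly monotone, so it can serve as the
  independent variable. The choice \<open>y = 1 - Z powr (1 - \<alpha>)\<close>, which runs from \<open>0\<close> at the front
  \<open>\<xi> = 0\<close> to \<open>1\<close> at \<open>\<xi> = -l\<close>, removes the factor \<open>Z powr \<alpha>\<close>, which for \<open>\<alpha> > 0\<close>
  is not Lipschitz at the burnt end, and turns the reaction zone into a scalar initial value problem
  \<open>\<beta> U' = slope y U\<close>, \<open>U 0 = Ti\<close> on \<open>[0,1]\<close>, with \<open>U y\<close> the value of \<open>T\<close>. In front of and behind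
  the zone the equation for \<open>T\<close> is autonomous and solved in closed form. A bounded continuation
  behind the zone exists as soon as \<open>T0 c \<le> U 1\<close>, and it is the constant \<open>T0 c\<close> when
  \<open>U 1 = T0 c\<close>. Hence such orbits yield waves (\<open>wave_of_orbit\<close>), and conversely every wave
  yields an orbit (\<open>orbit_of_wave\<close>).

  It remains to see for which \<open>\<beta>\<close> the orbit ends at or above \<open>T0 c\<close>. An orbit that ends exactly
  at \<open>T0 c\<close> is strictly increasing on the way (\<open>critical_orbit_flux_pos\<close>); as the right-hand side
  is divided by \<open>\<beta>\<close>, it is therefore a strict subsolution for every smaller viscosity. So at
  most one viscosity is critical (\<open>critical_viscosity_unique\<close>), and if there is one, it is
  \<open>\<beta>0 c\<close> (\<open>\<beta>0_eqI\<close>). For small viscosity the orbit overshoots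
  \<open>T0 c\<close> (\<open>small_viscosity_overshoots\<close>), and \<open>U 1\<close> depends continuously on \<open>1/\<beta>\<close>. If the orbit
  for \<open>\<beta>\<close> ended below \<open>T0 c\<close>, the intermediate value theorem would give a critical viscosity
  not exceeding \<open>\<beta>\<close>, that is \<open>\<beta>0 c \<le> \<beta>\<close>. For \<open>\<beta>\<close> below the minimum of \<open>\<beta>0\<close> this is excluded at
  every speed, so the orbit ends at or above \<open>T0 c\<close> and there is a wave.
\<close>

section \<open>Scalar differential equations\<close>

text \<open>
  Go back from a negative value to the last time at which \<open>d\<close> was nonnegative: from then on
  \<open>exp (- L t) d(t)\<close> is nondecreasing, so it could not have become negative. Only the derivative
  at times with \<open>d < 0\<close> enters; this one-sidedness is what lets barriers be checked only beyond
  the barrier.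
\<close>

lemma nonneg_if_deriv_ge_when_negative:
  fixes d d' :: "real \<Rightarrow> real"
  assumes cont: "continuous_on {a..b} d"
    and der: "\<And>t. a < t \<Longrightarrow> t < b \<Longrightarrow> d t < 0 \<Longrightarrow> (d has_real_derivative d' t) (at t)"
    and ge: "\<And>t. a < t \<Longrightarrow> t < b \<Longrightarrow> d t < 0 \<Longrightarrow> L * d t \<le> d' t"
    and init: "0 \<le> d a" and t: "a \<le> t" "t \<le> b"
  shows "0 \<le> d t"
proof (rule ccontr)
  assume "\<not> 0 \<le> d t"
  define S where "S = {s \<in> {a..t}. 0 \<le> d s}"
  have cont_t: "continuous_on {a..t} d"
    using continuous_on_subset[OF cont] t by auto
  have "S = {a..t} \<inter> d -` {0..}" by (auto simp: S_def)
  then have "closed S"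
    using continuous_closed_preimage[OF cont_t, of "{0..}"] by auto
  then have "compact S"
    by (metis (no_types, lifting) S_def bounded_subset bounded_closed_interval compact_eq_bounded_closed mem_Collect_eq subsetI)
  moreover have "a \<in> S" using init t by (simp add: S_def)
  ultimately obtain s where s: "s \<in> S" "\<And>r. r \<in> S \<Longrightarrow> r \<le> s"
    using compact_attains_sup[of S] by blast
  have st: "a \<le> s" "s < t" "0 \<le> d s" 
    using s(1) \<open>\<not> 0 \<le> d t\<close> by (auto simp: S_def less_le)
  have neg: "d r < 0" if "s < r" "r \<le> t" for r
    using s(2)[of r] that st by (force simp: S_def)
  have "d s * exp (- L * s) \<le> d t * exp (- L * t)"
  proof (rule DERIV_nonneg_imp_increasing_open[where f = "\<lambda>r. d r * exp (- L * r)"])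
    fix r assume r: "s < r" "r < t"
    have "((\<lambda>r. d r * exp (- L * r)) has_real_derivative
        d' r * exp (- L * r) + d r * (exp (- L * r) * - L)) (at r)"
      using r st t neg[of r] by (auto intro!: derivative_eq_intros der)
    moreover have "0 \<le> (d' r - L * d r) * exp (- L * r)"
      using ge[of r] r st t neg[of r] by simp
    ultimately show "\<exists>y. ((\<lambda>r. d r * exp (- L * r)) has_real_derivative y) (at r) \<and> 0 \<le> y"
      by (auto simp: algebra_simps)
  next
    show "continuous_on {s..t} (\<lambda>r. d r * exp (- L * r))"
      by (intro continuous_intros continuous_on_subset[OF cont_t]) (use st in auto)
  qed (use st in simp)
  moreover have "0 \<le> d s * exp (- L * s)" using st by simp
  moreover have "d t * exp (- L * t) < 0" using neg[of t] st by (simp add: mult_neg_pos)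
  ultimately show False by linarith
qed

text \<open>
  Where \<open>w - v\<close> is negative, the Lipschitz bound gives \<open>(w - v)' \<ge> L (w - v)\<close>.
\<close>

lemma subsolution_le_supersolution:
  fixes g :: "real \<Rightarrow> real \<Rightarrow> real"
  assumes lip: "\<And>t x y. a < t \<Longrightarrow> t < b \<Longrightarrow> \<bar>g t x - g t y\<bar> \<le> L * \<bar>x - y\<bar>"
    and cont: "continuous_on {a..b} v" "continuous_on {a..b} w"
    and der_v: "\<And>t. a < t \<Longrightarrow> t < b \<Longrightarrow> (v has_real_derivative v' t) (at t)"
    and der_w: "\<And>t. a < t \<Longrightarrow> t < b \<Longrightarrow> (w has_real_derivative w' t) (at t)"
    and sub: "\<And>t. a < t \<Longrightarrow> t < b \<Longrightarrow> v' t \<le> g t (v t)"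
    and super: "\<And>t. a < t \<Longrightarrow> t < b \<Longrightarrow> g t (w t) \<le> w' t"
    and init: "v a \<le> w a" and t: "a \<le> t" "t \<le> b"
  shows "v t \<le> w t"
proof -
  have "0 \<le> w t - v t"
  proof (rule nonneg_if_deriv_ge_when_negative[where a = a and b = b and L = L
      and d = "\<lambda>t. w t - v t" and d' = "\<lambda>t. w' t - v' t"])
    fix s assume s: "a < s" "s < b" "w s - v s < 0"
    show "((\<lambda>t. w t - v t) has_real_derivative w' s - v' s) (at s)"
      using s by (intro DERIV_diff der_v der_w)
    show "L * (w s - v s) \<le> w' s - v' s"
      using lip[OF s(1,2), of "w s" "v s"] sub[of s] super[of s] s by (simp add: algebra_simps)
  qed (use init t cont in \<open>auto intro: continuous_intros\<close>)
  then show ?thesis by simp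
qed

text \<open>
  With \<open>v \<le> w\<close> already known, the Lipschitz bound makes \<open>exp (L t) (w - v)\<close> nondecreasing, and
  strictly increasing if \<open>v\<close> is a strict subsolution.
\<close>

lemma subsolution_less_supersolution:
  fixes g :: "real \<Rightarrow> real \<Rightarrow> real"
  assumes lip: "\<And>t x y. a < t \<Longrightarrow> t < b \<Longrightarrow> \<bar>g t x - g t y\<bar> \<le> L * \<bar>x - y\<bar>"
    and cont: "continuous_on {a..b} v" "continuous_on {a..b} w"
    and der_v: "\<And>t. a < t \<Longrightarrow> t < b \<Longrightarrow> (v has_real_derivative v' t) (at t)"
    and der_w: "\<And>t. a < t \<Longrightarrow> t < b \<Longrightarrow> (w has_real_derivative w' t) (at t)"
    and sub: "\<And>t. a < t \<Longrightarrow> t < b \<Longrightarrow> v' t \<le> g t (v t)"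
    and super: "\<And>t. a < t \<Longrightarrow> t < b \<Longrightarrow> g t (w t) \<le> w' t"
    and init: "v a \<le> w a" and ab: "a < b"
    and strict: "v a < w a \<or> (\<forall>t. a < t \<and> t < b \<longrightarrow> v' t < g t (v t))"
  shows "v b < w b"
proof -
  have le: "v t \<le> w t" if "a \<le> t" "t \<le> b" for t
    using subsolution_le_supersolution[OF lip cont der_v der_w sub super init] that by blast
  define k where "k t = (w t - v t) * exp (L * t)" for t
  define k' where "k' t = (w' t - v' t + L * (w t - v t)) * exp (L * t)" for t
  have der: "(k has_real_derivative k' t) (at t)" if "a < t" "t < b" for t
    unfolding k_def k'_def
    by (rule derivative_eq_intros der_v der_w that refl)+ (simp add: algebra_simps)
  have gap: "g t (v t) - v' t \<le> w' t - v' t + L * (w t - v t)" if "a < t" "t < b" for t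
    using lip[OF that, of "w t" "v t"] le[of t] super[OF that] that by (simp add: algebra_simps)
  have cont_k: "continuous_on {a..b} k"
    unfolding k_def by (intro continuous_intros cont)
  from strict have "0 < k b"
  proof
    assume "v a < w a"
    then have "0 < k a" by (simp add: k_def)
    also have "k a \<le> k b"
      by (rule DERIV_nonneg_imp_increasing_open[OF _ _ cont_k])
         (use ab der gap sub in \<open>force simp: k'_def\<close>)+
    finally show ?thesis .
  next
    assume *: "\<forall>t. a < t \<and> t < b \<longrightarrow> v' t < g t (v t)"
    have "0 \<le> k a" using init by (simp add: k_def)
    also have "k a < k b"
      by (rule DERIV_pos_imp_increasing_open[OF ab _ cont_k])
         (use der gap * in \<open>force simp: k'_def\<close>)+
    finally show ?thesis .
  qed
  then show ?thesis by (simp add: k_def zero_less_mult_iff)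
qed

text \<open>
  The Picard operator is a contraction for the norm weighted by \<open>exp (- l t)\<close> once \<open>l\<close> is at
  least \<open>2L\<close>, so that the whole interval is covered in a single step. The weight is absorbed into the
  unknown \<open>w t = exp (- l t) u t\<close>, and functions on \<open>[0,1]\<close> are extended constantly, which puts
  the argument into the complete space of bounded continuous functions on the line.
\<close>

lemma ivp_solution_exists:
  fixes g :: "real \<Rightarrow> real \<Rightarrow> real"
  assumes cont: "continuous_on ({0..1} \<times> UNIV) (\<lambda>(t, x). g t x)"
    and lip: "\<And>t x y. 0 \<le> t \<Longrightarrow> t \<le> 1 \<Longrightarrow> \<bar>g t x - g t y\<bar> \<le> L * \<bar>x - y\<bar>"
  obtains u where "u 0 = x0" "continuous_on {0..1} u"
    "\<And>t. 0 < t \<Longrightarrow> t < 1 \<Longrightarrow> (u has_real_derivative g t (u t)) (at t)"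
proof -
  define l where "l = 2 * \<bar>L\<bar> + 1"
  have l: "0 < l" "\<bar>L\<bar> / l \<le> 1/2" by (auto simp: l_def field_simps)
  define cl where "cl t = max 0 (min 1 t)" for t :: real
  have cl: "cl t \<in> {0..1}" "t \<in> {0..1} \<Longrightarrow> cl t = t" for t by (auto simp: cl_def)
  have contg: "continuous_on {0..1} (\<lambda>s. g s (w s))" if "continuous_on {0..1} w" for w
  proof -
    have "continuous_on {0..1} (\<lambda>s. (s, w s))" using that by (intro continuous_intros)
    from continuous_on_compose2[OF cont this] show ?thesis by (simp add: image_subset_iff)
  qed
  define I where "I w y = integral {0..y} (\<lambda>s. g s (exp (l * s) * w s))" for w y
  define P where "P w y = exp (- l * cl y) * (x0 + I w (cl y))" for w y
  have contb: "continuous_on {0..1} (\<lambda>s. g s (exp (l * s) * apply_bcontfun w s))" for w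
    by (intro contg continuous_intros) (auto intro: continuous_on_subset[OF continuous_on_apply_bcontfun])
  have int: "(\<lambda>s. g s (exp (l * s) * apply_bcontfun w s)) integrable_on {0..y}" if "y \<in> {0..1}" for w y
    by (rule integrable_continuous_real, rule continuous_on_subset[OF contb]) (use that in auto)
  have contI: "continuous_on {0..1} (I (apply_bcontfun w))" for w
    unfolding I_def by (rule indefinite_integral_continuous_1) (use int in auto)
  have contP: "continuous_on UNIV (P (apply_bcontfun w))" for w
  proof -
    have c: "continuous_on UNIV cl" unfolding cl_def by (intro continuous_intros)
    have "continuous_on UNIV (\<lambda>y. I (apply_bcontfun w) (cl y))"
      by (rule continuous_on_compose2[OF contI c]) (use cl in auto)
    then show ?thesis unfolding P_def by (intro continuous_intros c)
  qed
  have bP: "P (apply_bcontfun w) \<in> bcontfun" for w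
  proof -
    have "range (P (apply_bcontfun w)) \<subseteq> P (apply_bcontfun w) ` {0..1}"
      using cl by (fastforce simp: P_def image_iff)
    moreover have "bounded (P (apply_bcontfun w) ` {0..1})"
      by (intro compact_imp_bounded compact_continuous_image continuous_on_subset[OF contP]) auto
    ultimately have "bounded (range (P (apply_bcontfun w)))" using bounded_subset by blast
    then show ?thesis using contP by (simp add: bcontfun_def)
  qed
  define Q where "Q w = Bcontfun (P (apply_bcontfun w))" for w
  have Q: "apply_bcontfun (Q w) = P (apply_bcontfun w)" for w
    using bP by (simp add: Q_def Bcontfun_inverse)
  have contr: "dist (Q w) (Q z) \<le> 1/2 * dist w z" for w z
  proof (rule dist_bound)
    fix t
    define y where "y = cl t"
    have y: "y \<in> {0..1}" using cl by (simp add: y_def)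
    have exp_int: "((\<lambda>s. \<bar>L\<bar> * dist w z * exp (l * s)) has_integral
        \<bar>L\<bar> * dist w z * (exp (l * y) / l) - \<bar>L\<bar> * dist w z * (exp (l * 0) / l)) {0..y}"
      by (rule fundamental_theorem_of_calculus)
         (use y l in \<open>auto intro!: derivative_eq_intros
            simp: has_real_derivative_iff_has_vector_derivative[symmetric]\<close>)
    have "norm (I (apply_bcontfun w) y - I (apply_bcontfun z) y)
        = norm (integral {0..y} (\<lambda>s. g s (exp (l * s) * apply_bcontfun w s) - g s (exp (l * s) * apply_bcontfun z s)))"
      unfolding I_def by (subst integral_diff) (use int y in auto)
    also have "\<dots> \<le> integral {0..y} (\<lambda>s. \<bar>L\<bar> * dist w z * exp (l * s))"
    proof (rule integral_norm_bound_integral)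
      fix s assume s: "s \<in> {0..y}"
      have "norm (g s (exp (l * s) * apply_bcontfun w s) - g s (exp (l * s) * apply_bcontfun z s))
          \<le> L * \<bar>exp (l * s) * apply_bcontfun w s - exp (l * s) * apply_bcontfun z s\<bar>"
        using lip[of s] s y by simp
      also have "\<dots> = L * (exp (l * s) * dist (apply_bcontfun w s) (apply_bcontfun z s))"
        by (simp add: dist_real_def abs_mult flip: right_diff_distrib)
      also have "\<dots> \<le> \<bar>L\<bar> * (exp (l * s) * dist w z)"
        by (intro mult_mono dist_bounded) auto
      finally show "norm (g s (exp (l * s) * apply_bcontfun w s) - g s (exp (l * s) * apply_bcontfun z s))
          \<le> \<bar>L\<bar> * dist w z * exp (l * s)" by (simp add: ac_simps)
    qed (use int y exp_int in \<open>auto intro: integrable_diff\<close>)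
    also have "\<dots> = \<bar>L\<bar> * dist w z * (exp (l * y) / l) - \<bar>L\<bar> * dist w z * (exp (l * 0) / l)"
      using exp_int by (rule integral_unique)
    also have "\<dots> \<le> (\<bar>L\<bar> / l) * dist w z * exp (l * y)"
      using l by (simp add: field_simps)
    also have "\<dots> \<le> 1/2 * dist w z * exp (l * y)"
      using l by (intro mult_right_mono) auto
    finally have "exp (- l * y) * norm (I (apply_bcontfun w) y - I (apply_bcontfun z) y)
        \<le> exp (- l * y) * (1/2 * dist w z * exp (l * y))"
      by (intro mult_left_mono) auto
    also have "\<dots> = 1/2 * dist w z" by (simp add: exp_minus)
    finally have "exp (- l * y) * norm (I (apply_bcontfun w) y - I (apply_bcontfun z) y) \<le> 1/2 * dist w z" .
    moreover have "dist (apply_bcontfun (Q w) t) (apply_bcontfun (Q z) t)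
        = exp (- l * y) * norm (I (apply_bcontfun w) y - I (apply_bcontfun z) y)"
    proof -
      have "apply_bcontfun (Q w) t - apply_bcontfun (Q z) t
          = exp (- l * y) * (I (apply_bcontfun w) y - I (apply_bcontfun z) y)"
        unfolding Q P_def y_def[symmetric] by (simp add: algebra_simps)
      then show ?thesis by (simp add: dist_real_def abs_mult)
    qed
    ultimately show "dist (apply_bcontfun (Q w) t) (apply_bcontfun (Q z) t) \<le> 1/2 * dist w z"
      by (simp only:)
  qed
  obtain w where w: "Q w = w"
    using banach_fix_type[of "1/2" Q] contr by auto
  define u where "u t = x0 + I (apply_bcontfun w) t" for t
  have u: "exp (l * t) * apply_bcontfun w t = u t" if "t \<in> {0..1}" for t
  proof -
    have "apply_bcontfun w t = P (apply_bcontfun w) t" using w Q by metis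
    then show ?thesis using that cl(2)[OF that] by (simp add: P_def u_def exp_minus)
  qed
  have contu: "continuous_on {0..1} u"
    unfolding u_def by (intro continuous_intros contI)
  show thesis
  proof (rule that[OF _ contu])
    show "u 0 = x0" by (simp add: u_def I_def)
    fix t :: real assume t: "0 < t" "t < 1"
    have "(I (apply_bcontfun w) has_real_derivative g t (exp (l * t) * apply_bcontfun w t)) (at t within {0..1})"
      unfolding I_def by (rule integral_has_real_derivative[OF contb]) (use t in auto)
    then have "(u has_real_derivative g t (u t)) (at t within {0..1})"
      unfolding u_def[abs_def] using u[of t] t by (auto intro!: derivative_eq_intros simp: u_def)
    then show "(u has_real_derivative g t (u t)) (at t)"
      using t by (simp add: at_within_Icc_at)
  qed
qed

text \<open>
  An energy estimate: for \<open>e = u - v\<close> the Lipschitz bound and Young's inequality give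
  \<open>(e\<^sup>2)' \<le> (2 P L + 1) e\<^sup>2 + (M (p - q))\<^sup>2\<close>.
\<close>

lemma ivp_parameter_dependence:
  fixes g :: "real \<Rightarrow> real \<Rightarrow> real"
  assumes lip: "\<And>t x y. 0 < t \<Longrightarrow> t < 1 \<Longrightarrow> \<bar>g t x - g t y\<bar> \<le> L * \<bar>x - y\<bar>"
    and bound: "\<And>t x. 0 < t \<Longrightarrow> t < 1 \<Longrightarrow> \<bar>g t x\<bar> \<le> M"
    and cont: "continuous_on {0..1} u" "continuous_on {0..1} v"
    and der_u: "\<And>t. 0 < t \<Longrightarrow> t < 1 \<Longrightarrow> (u has_real_derivative p * g t (u t)) (at t)"
    and der_v: "\<And>t. 0 < t \<Longrightarrow> t < 1 \<Longrightarrow> (v has_real_derivative q * g t (v t)) (at t)"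
    and init: "u 0 = v 0" and p: "0 \<le> p" "p \<le> P"
  shows "\<bar>u 1 - v 1\<bar> \<le> exp (P * L + 1/2) * M * \<bar>p - q\<bar>"
proof -
  have L: "0 \<le> L" using lip[of "1/2" 1 0] by simp
  have M: "0 \<le> M" using bound[of "1/2" 0] by simp
  define k where "k = 2 * (P * L + 1/2)"
  define C where "C = (M * \<bar>p - q\<bar>)\<^sup>2"
  define E where "E t = (u t - v t)\<^sup>2 * exp (- k * t) - C * t" for t
  have "E 1 \<le> E 0"
  proof (rule DERIV_nonpos_imp_decreasing_open[where f = E])
    fix t :: real assume t: "0 < t" "t < 1"
    define e where "e = u t - v t"
    define f where "f = p * g t (u t) - q * g t (v t)"
    have "(E has_real_derivative (2 * e * f - k * e\<^sup>2) * exp (- k * t) - C) (at t)"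
      unfolding E_def e_def f_def
      by (rule derivative_eq_intros der_u der_v t refl)+ (simp add: algebra_simps)
    moreover have "2 * e * f \<le> k * e\<^sup>2 + C"
    proof -
      have "\<bar>p * (g t (u t) - g t (v t))\<bar> \<le> P * (L * \<bar>e\<bar>)"
        unfolding abs_mult e_def using p lip[OF t] by (intro mult_mono) auto
      moreover have "\<bar>(p - q) * g t (v t)\<bar> \<le> \<bar>p - q\<bar> * M"
        unfolding abs_mult using bound[OF t] by (intro mult_mono) auto
      moreover have "f = p * (g t (u t) - g t (v t)) + (p - q) * g t (v t)"
        by (simp add: f_def algebra_simps)
      ultimately have "\<bar>f\<bar> \<le> P * L * \<bar>e\<bar> + M * \<bar>p - q\<bar>" by (simp add: ac_simps)
      then have "\<bar>e\<bar> * \<bar>f\<bar> \<le> \<bar>e\<bar> * (P * L * \<bar>e\<bar> + M * \<bar>p - q\<bar>)"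
        by (intro mult_left_mono) auto
      moreover have "e * f \<le> \<bar>e\<bar> * \<bar>f\<bar>" by (simp flip: abs_mult)
      moreover have "2 * (\<bar>e\<bar> * (M * \<bar>p - q\<bar>)) \<le> e\<^sup>2 + C"
        using sum_squares_bound[of "\<bar>e\<bar>" "M * \<bar>p - q\<bar>"] by (simp add: C_def)
      ultimately show ?thesis
        by (simp add: k_def algebra_simps power2_eq_square)
    qed
    moreover have "(2 * e * f - k * e\<^sup>2) * exp (- k * t) \<le> C * 1"
    proof -
      have "0 \<le> k" using L p by (simp add: k_def)
      then have "exp (- k * t) \<le> 1" using t by simp
      then have "C * exp (- k * t) \<le> C * 1" by (intro mult_left_mono) (auto simp: C_def)
      moreover have "(2 * e * f - k * e\<^sup>2) * exp (- k * t) \<le> C * exp (- k * t)"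
        using \<open>2 * e * f \<le> k * e\<^sup>2 + C\<close> by (intro mult_right_mono) auto
      ultimately show ?thesis by linarith
    qed
    ultimately show "\<exists>y. (E has_real_derivative y) (at t) \<and> y \<le> 0"
      by (intro exI[of _ "(2 * e * f - k * e\<^sup>2) * exp (- k * t) - C"]) auto
  next
    show "continuous_on {0..1} E" unfolding E_def by (intro continuous_intros cont)
  qed simp
  then have "(u 1 - v 1)\<^sup>2 * exp (- k) \<le> C" by (simp add: E_def init)
  then have "(u 1 - v 1)\<^sup>2 * exp (- k) * exp k \<le> C * exp k" by (intro mult_right_mono) auto
  then have "(u 1 - v 1)\<^sup>2 \<le> C * exp k" by (simp add: mult.assoc flip: exp_add)
  also have "exp k = (exp (P * L + 1/2))\<^sup>2" unfolding k_def by (rule exp_double)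
  also have "C * (exp (P * L + 1/2))\<^sup>2 = (exp (P * L + 1/2) * M * \<bar>p - q\<bar>)\<^sup>2"
    by (simp add: C_def power_mult_distrib)
  finally have "\<bar>u 1 - v 1\<bar>\<^sup>2 \<le> (exp (P * L + 1/2) * M * \<bar>p - q\<bar>)\<^sup>2" by simp
  then show ?thesis by (rule power2_le_imp_le) (use M in simp)
qed


section \<open>Inverting and gluing real functions\<close>

text \<open>
  Stated with continuity at the end points, since the equation for \<open>Z\<close> holds in the open reaction
  zone and says nothing about derivatives at its ends.
\<close>

lemma increasing_inverse:
  fixes h h' :: "real \<Rightarrow> real"
  assumes ab: "a < b" and cont: "continuous_on {a..b} h"
    and der: "\<And>x. a < x \<Longrightarrow> x < b \<Longrightarrow> (h has_real_derivative h' x) (at x)"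
    and pos: "\<And>x. a < x \<Longrightarrow> x < b \<Longrightarrow> 0 < h' x"
  obtains k where "h a < h b" "k (h a) = a" "k (h b) = b" "continuous_on {h a..h b} k"
    "\<And>y. h a < y \<Longrightarrow> y < h b \<Longrightarrow> a < k y \<and> k y < b \<and> h (k y) = y"
    "\<And>y. h a < y \<Longrightarrow> y < h b \<Longrightarrow> (k has_real_derivative inverse (h' (k y))) (at y)"
proof -
  have less: "h x < h y" if "a \<le> x" "x < y" "y \<le> b" for x y
    by (rule DERIV_pos_imp_increasing_open[OF that(2)])
       (use that der pos in \<open>force intro: continuous_on_subset[OF cont]\<close>)+
  have inj: "inj_on h {a..b}"
    by (rule linorder_inj_onI') (use less in force)
  define k where "k = the_inv_into {a..b} h"
  have img: "h ` {a..b} = {h a..h b}"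
  proof
    show "h ` {a..b} \<subseteq> {h a..h b}"
      using less by (force simp: le_less)
    show "{h a..h b} \<subseteq> h ` {a..b}"
      using IVT'[OF _ _ _ cont] ab by force
  qed
  have kh: "k (h x) = x" if "a \<le> x" "x \<le> b" for x
    unfolding k_def using that by (intro the_inv_into_f_f[OF inj]) auto
  have hk: "h (k y) = y" "k y \<in> {a..b}" if "h a \<le> y" "y \<le> h b" for y
    unfolding k_def using that img f_the_inv_into_f[OF inj, of y] the_inv_into_into[OF inj, of y "{a..b}"]
    by auto
  have contk: "continuous_on {h a..h b} k"
    unfolding k_def img[symmetric] by (rule continuous_on_inv_into[OF cont _ inj]) simp
  have inside: "a < k y \<and> k y < b \<and> h (k y) = y" if "h a < y" "y < h b" for y
    using hk[of y] that by (auto simp: less_le)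
  show thesis
  proof (rule that[of k])
    fix y assume y: "h a < y" "y < h b"
    show "a < k y \<and> k y < b \<and> h (k y) = y" using inside y .
    show "(k has_real_derivative inverse (h' (k y))) (at y)"
    proof (rule DERIV_inverse_function[where f = h and a = "h a" and b = "h b"])
      show "(h has_real_derivative h' (k y)) (at (k y))" using der inside[OF y] by blast
      show "h' (k y) \<noteq> 0" using pos inside[OF y] by force
      show "isCont k y"
        using continuous_on_interior[OF contk, of y] y by simp
    qed (use y inside in auto)
  qed (use kh contk ab less in auto)
qed

lemma continuous_on_three_pieces:
  fixes f g h :: "real \<Rightarrow> real"
  assumes "a \<le> b" "continuous_on {..a} f" "continuous_on {a..b} g" "continuous_on {b..} h"
    and "f a = g a" "g b = h b"
  shows "continuous_on UNIV (\<lambda>x. if x \<le> a then f x else if x \<le> b then g x else h x)"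
proof (rule continuous_on_cases_1)
  have "{t \<in> {a..}. t \<le> b} = {a..b}" "{t \<in> {a..}. b \<le> t} = {b..}" using assms(1) by auto
  then have "continuous_on {a..} (\<lambda>x. if x \<le> b then g x else h x)"
    using assms by (intro continuous_on_cases_1) auto
  then show "continuous_on {t \<in> UNIV. a \<le> t} (\<lambda>x. if x \<le> b then g x else h x)"
    by (simp add: atLeast_def)
  show "continuous_on {t \<in> UNIV. t \<le> a} f" using assms by (simp add: atMost_def)
qed (use assms in auto)

text \<open>
  This makes a function glued from several solutions continuously differentiable: by the
  fundamental theorem of calculus it is an antiderivative of the continuous \<open>f'\<close>.
\<close>

lemma derivative_across_exceptional_points:
  fixes f f' :: "real \<Rightarrow> real"
  assumes "finite N" and cont: "continuous_on UNIV f" "continuous_on UNIV f'"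
    and der: "\<And>x. x \<notin> N \<Longrightarrow> (f has_real_derivative f' x) (at x)"
  shows "(f has_real_derivative f' x) (at x)"
proof -
  define F where "F y = f (x - 1) + integral {x - 1..y} f'" for y
  have eq: "F y = f y" if "y \<in> {x - 1..x + 1}" for y
  proof -
    have "(f' has_integral f y - f (x - 1)) {x - 1..y}"
      by (rule fundamental_theorem_of_calculus_interior_strong[OF \<open>finite N\<close>])
         (use that der cont in \<open>auto simp: has_real_derivative_iff_has_vector_derivative[symmetric]
            intro: continuous_on_subset\<close>)
    then show ?thesis by (simp add: F_def integral_unique)
  qed
  have "(F has_real_derivative f' x) (at x within {x - 1..x + 1})"
    unfolding F_def[abs_def]
    by (auto intro!: derivative_eq_intros integral_has_real_derivative continuous_on_subset[OF cont(2)])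
  then have "(f has_real_derivative f' x) (at x within {x - 1..x + 1})"
    by (rule has_field_derivative_transform_within[OF _ zero_less_one]) (use eq in auto)
  then show ?thesis by (simp add: at_within_Icc_at)
qed

text \<open>
  Written out, \<open>h x = (exp (d x) - 1) / d\<close>, with the limit \<open>h x = x\<close> for \<open>d = 0\<close>. Behind the
  reaction zone \<open>d\<close> is the distance of the two equilibria, and \<open>d = 0\<close> is the case \<open>c = c_cj\<close>.
\<close>

lemma linear_growth_solution:
  fixes d :: real
  assumes "0 \<le> d"
  obtains h :: "real \<Rightarrow> real" where "h 0 = 0" "\<And>x. (h has_real_derivative 1 + d * h x) (at x)"
    "\<And>x. 0 \<le> x \<Longrightarrow> x \<le> h x"
proof (cases "d = 0")
  case True
  then show ?thesis by (intro that[of "\<lambda>x. x"]) (auto intro!: derivative_eq_intros)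
next
  case False
  show ?thesis
  proof (rule that[of "\<lambda>x. (exp (d * x) - 1) / d"])
    show "x \<le> (exp (d * x) - 1) / d" for x
      using exp_ge_add_one_self[of "d * x"] False assms by (simp add: field_simps)
  qed (use False in \<open>auto intro!: derivative_eq_intros simp: field_simps\<close>)
qed

section \<open>The reaction zone as a scalar initial value problem\<close>

locale wave_speed = reactive_wave_model +
  fixes c :: real
  assumes c_ge: "c_cj \<le> c"
begin

definition T1 :: real where "T1 = c - sqrt (c\<^sup>2 - 2 * q0)"

text \<open>
  The value of \<open>Z\<close> at progress \<open>y = 1 - Z powr (1 - \<alpha>)\<close>.
\<close>

definition residual :: "real \<Rightarrow> real" where
  "residual y = (1 - y) powr (1 / (1 - \<alpha>))"

text \<open>
  In every zone the equation for \<open>T\<close> reads \<open>\<beta> T\<^sub>\<xi> = - flux T Z\<close>.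
\<close>

definition flux :: "real \<Rightarrow> real \<Rightarrow> real" where
  "flux T z = c * T - T\<^sup>2 / 2 - q0 * (1 - z)"

text \<open>
  The distance in \<open>\<xi>\<close> travelled per unit of progress \<open>y\<close>, namely \<open>- d\<xi>/dy\<close>.
\<close>

definition delay :: "real \<Rightarrow> real" where
  "delay T = 1 / ((1 - \<alpha>) * K * \<phi> T)"

definition slope :: "real \<Rightarrow> real \<Rightarrow> real" where
  "slope y T = flux T (residual y) * delay T"

text \<open>
  The temperature is cut off to \<open>[Ti, 2c]\<close>, where all relevant orbits stay, to make the equation
  globally Lipschitz and to keep \<open>\<phi>\<close> away from its jump at \<open>Ti\<close>.
\<close>

definition clamp :: "real \<Rightarrow> real" where
  "clamp T = max Ti (min (2 * c) T)"

text \<open>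
  Posed with the cut-off slope, so that an orbit exists for every viscosity. Whether it solves the
  original equation is decided afterwards by showing that it stays in \<open>[Ti, 2c]\<close>.
\<close>

definition orbit :: "real \<Rightarrow> (real \<Rightarrow> real) \<Rightarrow> bool" where
  "orbit \<beta> U \<longleftrightarrow> continuous_on {0..1} U \<and> U 0 = Ti \<and>
     (\<forall>y. 0 < y \<and> y < 1 \<longrightarrow> (U has_real_derivative slope y (clamp (U y)) / \<beta>) (at y))"

lemma orbitD:
  assumes "orbit \<beta> U"
  shows "continuous_on {0..1} U" "U 0 = Ti"
    "\<And>y. 0 < y \<Longrightarrow> y < 1 \<Longrightarrow> (U has_real_derivative slope y (clamp (U y)) / \<beta>) (at y)"
  using assms by (auto simp: orbit_def)

lemma c_facts: "Ti < c" "0 < c" "2 * q0 \<le> c\<^sup>2"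
proof -
  show "Ti < c" using Ti_less c_ge by (simp add: c_cj_def)
  then show "0 < c" using Ti_pos by simp
  have "(sqrt (2 * q0))\<^sup>2 \<le> c\<^sup>2"
    using c_ge q0_pos by (intro power_mono) (auto simp: c_cj_def)
  then show "2 * q0 \<le> c\<^sup>2" using q0_pos by simp
qed

lemma roots: "c \<le> T0 c" "T0 c < 2 * c" "0 < T1" "T1 \<le> c" "Ti < T0 c"
proof -
  have "sqrt (c\<^sup>2 - 2 * q0) < c"
    using real_sqrt_less_mono[of "c\<^sup>2 - 2 * q0" "c\<^sup>2"] q0_pos c_facts by simp
  moreover have "0 \<le> sqrt (c\<^sup>2 - 2 * q0)" using c_facts by simp
  ultimately show "c \<le> T0 c" "T0 c < 2 * c" "0 < T1" "T1 \<le> c" "Ti < T0 c"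
    using c_facts \<open>0 \<le> sqrt (c\<^sup>2 - 2 * q0)\<close> unfolding T0_def T1_def by linarith+
qed

text \<open>
  \<open>T0 c\<close> and \<open>T1\<close> are the equilibria of the burnt state \<open>z = 0\<close>. In particular
  \<open>flux (T0 c) z = q0 z\<close>, so the constant \<open>T0 c\<close> is a strict subsolution in the reaction zone.
\<close>

lemma flux_factor: "flux T z = (T0 c - T) * (T - T1) / 2 + q0 * z"
proof -
  have "(sqrt (c\<^sup>2 - 2 * q0))\<^sup>2 = c\<^sup>2 - 2 * q0" using c_facts by simp
  then show ?thesis
    by (simp add: flux_def T0_def T1_def field_simps power2_eq_square)
qed

lemma flux_mono: "z \<le> z' \<Longrightarrow> flux T z \<le> flux T z'"
  using q0_pos by (simp add: flux_def)

lemma delay_pos: "Ti \<le> T \<Longrightarrow> 0 < delay T"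
  using \<phi>_pos[of T] \<alpha>_less_1 K_pos by (simp add: delay_def)

lemma residual_0 [simp]: "residual 0 = 1" and residual_1 [simp]: "residual 1 = 0"
  by (auto simp: residual_def)

lemma residual_antimono: "y \<le> y' \<Longrightarrow> y' \<le> 1 \<Longrightarrow> residual y' \<le> residual y"
  unfolding residual_def using \<alpha>_less_1 by (intro powr_mono2) auto

lemma residual_pos: "y < 1 \<Longrightarrow> 0 < residual y"
  by (simp add: residual_def)

lemma residual_bounds: "0 \<le> y \<Longrightarrow> y \<le> 1 \<Longrightarrow> 0 \<le> residual y \<and> residual y \<le> 1"
  using residual_antimono[of 0 y] residual_antimono[of y 1] by simp

lemma continuous_residual: "continuous_on {..1} residual"
  unfolding residual_def using \<alpha>_less_1
  by (intro continuous_on_powr' continuous_intros) auto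

lemma clamp_bounds: "Ti \<le> clamp T" "clamp T \<le> 2 * c"
  using c_facts Ti_pos by (auto simp: clamp_def)

lemma clamp_id: "Ti \<le> T \<Longrightarrow> T \<le> 2 * c \<Longrightarrow> clamp T = T"
  by (simp add: clamp_def)

lemma clamp_lipschitz: "\<bar>clamp x - clamp y\<bar> \<le> \<bar>x - y\<bar>"
  by (auto simp: clamp_def max_def min_def)

lemma continuous_\<phi>: "continuous_on {Ti..} \<phi>"
  using \<phi>_smooth unfolding smooth_on_def
  by (metis DERIV_continuous continuous_on_eq_continuous_within)

lemma continuous_delay: "continuous_on {Ti..} delay"
  unfolding delay_def using \<phi>_pos \<alpha>_less_1 K_pos
  by (intro continuous_intros continuous_\<phi>) (auto simp: less_le)

text \<open>
  On the compact interval \<open>[Ti, 2c]\<close> the function \<open>delay\<close> is continuously differentiable, because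
  \<open>\<phi>\<close> is smooth and positive on \<open>[Ti, \<infinity>)\<close>; the factor \<open>residual y\<close> enters \<open>flux\<close> linearly and stays in
  \<open>[0,1]\<close>, so the bounds do not depend on \<open>y\<close>.
\<close>

lemma slope_bounds:
  obtains L M r where "0 \<le> L" "0 < r"
    "\<And>y x x'. 0 \<le> y \<Longrightarrow> y \<le> 1 \<Longrightarrow> \<bar>slope y (clamp x) - slope y (clamp x')\<bar> \<le> L * \<bar>x - x'\<bar>"
    "\<And>y x. 0 \<le> y \<Longrightarrow> y \<le> 1 \<Longrightarrow> \<bar>slope y (clamp x)\<bar> \<le> M"
    "\<And>x. r \<le> delay (clamp x)"
proof -
  define I where "I = {Ti..2 * c}"
  have I: "compact I" "convex I" "I \<noteq> {}" "I \<subseteq> {Ti..}"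
    using c_facts Ti_pos by (auto simp: I_def)
  have clI: "clamp x \<in> I" for x using clamp_bounds by (simp add: I_def)
  obtain D where D: "D 0 = \<phi>"
      "\<And>n x. x \<in> {Ti..} \<Longrightarrow> (D n has_real_derivative D (Suc n) x) (at x within {Ti..})"
    using \<phi>_smooth unfolding smooth_on_def by blast
  have contD: "continuous_on I (D 1)"
    using D(2) I(4) by (metis DERIV_continuous continuous_on_eq_continuous_within continuous_on_subset)
  define delay' where "delay' T = - D 1 T / ((1 - \<alpha>) * K * (\<phi> T)\<^sup>2)" for T
  have ne: "\<phi> T \<noteq> 0" "1 - \<alpha> \<noteq> 0" "K \<noteq> 0" if "T \<in> I" for T
    using that \<phi>_pos[of T] \<alpha>_less_1 K_pos by (auto simp: I_def)
  have der: "(delay has_real_derivative delay' T) (at T within I)" if T: "T \<in> I" for T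
  proof -
    have "(\<phi> has_real_derivative D 1 T) (at T within I)"
      using D(2)[of T 0] D(1) T I(4) by (auto intro: DERIV_subset)
    moreover have "delay = (\<lambda>T. inverse ((1 - \<alpha>) * K) * inverse (\<phi> T))"
      by (simp add: delay_def fun_eq_iff divide_inverse)
    ultimately show ?thesis
      using ne[OF T] by (auto intro!: derivative_eq_intros simp: delay'_def divide_simps power2_eq_square)
  qed
  have contI: "continuous_on I delay" "continuous_on I delay'"
    using continuous_on_subset[OF continuous_delay I(4)] continuous_on_subset[OF continuous_\<phi> I(4)]
      contD ne unfolding delay'_def by (auto intro!: continuous_intros)
  obtain B where B: "\<And>T. T \<in> I \<Longrightarrow> \<bar>delay T\<bar> \<le> B"
    using compact_imp_bounded[OF compact_continuous_image[OF contI(1) I(1)]]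
    unfolding bounded_iff by auto
  obtain B' where B': "\<And>T. T \<in> I \<Longrightarrow> \<bar>delay' T\<bar> \<le> B'"
    using compact_imp_bounded[OF compact_continuous_image[OF contI(2) I(1)]]
    unfolding bounded_iff by auto
  have B0: "0 \<le> B" "0 \<le> B'" using B[OF clI[of 0]] B'[OF clI[of 0]] by linarith+
  obtain t where t: "t \<in> I" "\<And>T. T \<in> I \<Longrightarrow> delay t \<le> delay T"
    using continuous_attains_inf[OF I(1,3) contI(1)] by blast
  have flux_le: "\<bar>flux T (residual y)\<bar> \<le> 2 * c\<^sup>2 + q0" if "T \<in> I" "0 \<le> y" "y \<le> 1" for T y
  proof -
    have "0 \<le> T * (2 * c - T)" "T * (2 * c - T) \<le> (2 * c) * (2 * c)"
      using that(1) Ti_pos c_facts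
      by (intro mult_nonneg_nonneg mult_mono; simp add: I_def)+
    moreover have "0 \<le> q0 * (1 - residual y)" "q0 * (1 - residual y) \<le> q0"
      using residual_bounds[OF that(2,3)] q0_pos by (auto simp: mult_le_cancel_left1)
    moreover have "flux T (residual y) = T * (2 * c - T) / 2 - q0 * (1 - residual y)"
      by (simp add: flux_def field_simps power2_eq_square)
    moreover have "(2 * c) * (2 * c) = 4 * c\<^sup>2" by (simp add: power2_eq_square)
    ultimately show ?thesis by linarith
  qed
  have C0: "0 \<le> 2 * c\<^sup>2 + q0" using q0_pos by (simp add: add_nonneg_nonneg)
  define L where "L = c * B + (2 * c\<^sup>2 + q0) * B'"
  have L0: "0 \<le> L" unfolding L_def using B0 c_facts q0_pos by auto
  show thesis
  proof (rule that[of L "delay t" "(2 * c\<^sup>2 + q0) * B"])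
    show "0 \<le> L" by (fact L0)
    show "0 < delay t" using delay_pos t I by auto
    show "delay t \<le> delay (clamp x)" for x using t clI by auto
    fix y x :: real assume y: "0 \<le> y" "y \<le> 1"
    show "\<bar>slope y (clamp x)\<bar> \<le> (2 * c\<^sup>2 + q0) * B"
      unfolding slope_def abs_mult using flux_le[OF clI y] B[OF clI] C0 by (intro mult_mono) auto
    fix x'
    have "norm (slope y (clamp x) - slope y (clamp x')) \<le> L * norm (clamp x - clamp x')"
    proof (rule field_differentiable_bound[OF I(2) _ _ clI clI,
          where f' = "\<lambda>T. (c - T) * delay T + flux T (residual y) * delay' T"])
      fix T assume T: "T \<in> I"
      show "(slope y has_real_derivative (c - T) * delay T + flux T (residual y) * delay' T) (at T within I)"
        unfolding slope_def[abs_def] flux_def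
        by (auto intro!: derivative_eq_intros der[OF T])
      have "\<bar>c - T\<bar> \<le> c" using T Ti_pos by (auto simp: I_def)
      then have "\<bar>(c - T) * delay T\<bar> \<le> c * B" "\<bar>flux T (residual y) * delay' T\<bar> \<le> (2 * c\<^sup>2 + q0) * B'"
        unfolding abs_mult using flux_le[OF T y] B[OF T] B'[OF T] C0 c_facts by (auto intro!: mult_mono)
      then show "norm ((c - T) * delay T + flux T (residual y) * delay' T) \<le> L"
        unfolding L_def by simp
    qed
    also have "\<dots> \<le> L * \<bar>x - x'\<bar>" using L0 clamp_lipschitz by (auto intro: mult_left_mono)
    finally show "\<bar>slope y (clamp x) - slope y (clamp x')\<bar> \<le> L * \<bar>x - x'\<bar>" by simp
  qed
qed

lemma slope_lipschitz:
  assumes "0 < \<beta>"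
  obtains L where "\<And>y x x'. 0 \<le> y \<Longrightarrow> y \<le> 1 \<Longrightarrow>
    \<bar>slope y (clamp x) / \<beta> - slope y (clamp x') / \<beta>\<bar> \<le> L * \<bar>x - x'\<bar>"
proof -
  obtain L where L: "\<And>y x x'. 0 \<le> y \<Longrightarrow> y \<le> 1 \<Longrightarrow> \<bar>slope y (clamp x) - slope y (clamp x')\<bar> \<le> L * \<bar>x - x'\<bar>"
    using slope_bounds by metis
  show thesis
  proof (rule that[of "L / \<beta>"])
    fix y x x' :: real assume "0 \<le> y" "y \<le> 1"
    from divide_right_mono[OF L[OF this, of x x'], of \<beta>] 
    show "\<bar>slope y (clamp x) / \<beta> - slope y (clamp x') / \<beta>\<bar> \<le> L / \<beta> * \<bar>x - x'\<bar>"
      using assms by (simp add: abs_divide flip: diff_divide_distrib)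
  qed
qed

lemma slope_sign:
  assumes "Ti \<le> T"
  shows "slope y T \<le> 0 \<longleftrightarrow> flux T (residual y) \<le> 0" "0 \<le> slope y T \<longleftrightarrow> 0 \<le> flux T (residual y)"
    "0 < slope y T \<longleftrightarrow> 0 < flux T (residual y)"
  using delay_pos[OF assms] by (auto simp: slope_def mult_le_0_iff zero_le_mult_iff zero_less_mult_iff)

section \<open>Comparison of orbits\<close>

text \<open>
  Constants are the barriers used below: \<open>\<tau>\<close> is a subsolution where \<open>flux \<tau>\<close> is nonnegative, and a
  supersolution where it is nonpositive.
\<close>

lemma orbit_above_constant:
  assumes \<beta>: "0 < \<beta>" and U: "orbit \<beta> U" and ab: "0 \<le> a" "a \<le> t" "t \<le> b" "b \<le> 1"
    and \<tau>: "Ti \<le> \<tau>" "\<tau> \<le> 2 * c" and init: "\<tau> \<le> U a"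
    and sub: "\<And>y. a < y \<Longrightarrow> y < b \<Longrightarrow> 0 \<le> flux \<tau> (residual y)"
  shows "\<tau> \<le> U t"
proof -
  obtain L where L: "\<And>y x x'. 0 \<le> y \<Longrightarrow> y \<le> 1 \<Longrightarrow>
      \<bar>slope y (clamp x) / \<beta> - slope y (clamp x') / \<beta>\<bar> \<le> L * \<bar>x - x'\<bar>"
    using slope_lipschitz[OF \<beta>] by blast
  show ?thesis
  proof (rule subsolution_le_supersolution[where v = "\<lambda>_. \<tau>" and w = U and a = a and b = b
        and g = "\<lambda>y x. slope y (clamp x) / \<beta>" and L = L and v' = "\<lambda>_. 0"])
    show "continuous_on {a..b} U" 
      using orbitD(1)[OF U] ab by (auto intro: continuous_on_subset)
    show "0 \<le> slope y (clamp \<tau>) / \<beta>" if "a < y" "y < b" for y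
      using sub[OF that] slope_sign(2)[OF \<tau>(1)] \<tau> \<beta> by (simp add: clamp_id)
  qed (use orbitD(3)[OF U] ab L init in auto)
qed

lemma orbit_strictly_above_constant:
  assumes \<beta>: "0 < \<beta>" and U: "orbit \<beta> U" and ab: "0 \<le> a" "a < b" "b \<le> 1"
    and \<tau>: "Ti \<le> \<tau>" "\<tau> \<le> 2 * c" and init: "\<tau> \<le> U a"
    and sub: "\<And>y. a < y \<Longrightarrow> y < b \<Longrightarrow> 0 < flux \<tau> (residual y)"
  shows "\<tau> < U b"
proof -
  obtain L where L: "\<And>y x x'. 0 \<le> y \<Longrightarrow> y \<le> 1 \<Longrightarrow>
      \<bar>slope y (clamp x) / \<beta> - slope y (clamp x') / \<beta>\<bar> \<le> L * \<bar>x - x'\<bar>"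
    using slope_lipschitz[OF \<beta>] by blast
  have pos: "0 < slope y (clamp \<tau>) / \<beta>" if "a < y" "y < b" for y
    using sub[OF that] slope_sign(3)[OF \<tau>(1)] \<tau> \<beta> by (simp add: clamp_id)
  show ?thesis
  proof (rule subsolution_less_supersolution[where v = "\<lambda>_. \<tau>" and w = U and a = a and b = b
        and g = "\<lambda>y x. slope y (clamp x) / \<beta>" and L = L and v' = "\<lambda>_. 0"])
    show "continuous_on {a..b} U" 
      using orbitD(1)[OF U] ab by (auto intro: continuous_on_subset)
  qed (use orbitD(3)[OF U] ab L init pos in \<open>auto intro: less_imp_le\<close>)
qed

lemma orbit_below_constant:
  assumes \<beta>: "0 < \<beta>" and U: "orbit \<beta> U" and ab: "0 \<le> a" "a \<le> t" "t \<le> b" "b \<le> 1"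
    and \<tau>: "Ti \<le> \<tau>" "\<tau> \<le> 2 * c" and init: "U a \<le> \<tau>"
    and super: "\<And>y. a < y \<Longrightarrow> y < b \<Longrightarrow> flux \<tau> (residual y) \<le> 0"
  shows "U t \<le> \<tau>"
proof -
  obtain L where L: "\<And>y x x'. 0 \<le> y \<Longrightarrow> y \<le> 1 \<Longrightarrow>
      \<bar>slope y (clamp x) / \<beta> - slope y (clamp x') / \<beta>\<bar> \<le> L * \<bar>x - x'\<bar>"
    using slope_lipschitz[OF \<beta>] by blast
  show ?thesis
  proof (rule subsolution_le_supersolution[where v = U and w = "\<lambda>_. \<tau>" and a = a and b = b
        and g = "\<lambda>y x. slope y (clamp x) / \<beta>" and L = L and w' = "\<lambda>_. 0"])
    show "continuous_on {a..b} U" 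
      using orbitD(1)[OF U] ab by (auto intro: continuous_on_subset)
    show "slope y (clamp \<tau>) / \<beta> \<le> 0" if "a < y" "y < b" for y
      using super[OF that] slope_sign(1)[OF \<tau>(1)] \<tau> \<beta> by (simp add: clamp_id divide_le_0_iff)
  qed (use orbitD(3)[OF U] ab L init in auto)
qed

lemma orbit_le:
  assumes "0 < \<beta>" "orbit \<beta> U" "0 \<le> t" "t \<le> 1"
  shows "U t \<le> 2 * c"
proof (rule orbit_below_constant[OF assms(1,2), where a = 0 and b = 1])
  show "U 0 \<le> 2 * c" using assms(2) c_facts Ti_pos by (simp add: orbit_def)
  show "flux (2 * c) (residual y) \<le> 0" if "0 < y" "y < 1" for y
    using residual_bounds[of y] that q0_pos by (simp add: flux_def power2_eq_square)
qed (use assms c_facts Ti_pos in auto)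

text \<open>
  \<open>flux Ti (residual y)\<close> decreases in \<open>y\<close>. As long as it is positive, \<open>Ti\<close> is a strict lower
  barrier; once it is nonpositive, \<open>Ti\<close> is an upper barrier, and an orbit at or below \<open>Ti\<close> would stay there
  up to \<open>y = 1\<close>.
\<close>

lemma orbit_gt_Ti:
  assumes \<beta>: "0 < \<beta>" and U: "orbit \<beta> U" and end1: "T0 c \<le> U 1" and t: "0 < t" "t \<le> 1"
  shows "Ti < U t"
proof (rule ccontr)
  assume neg: "\<not> Ti < U t"
  have Ti_le: "Ti \<le> 2 * c" using c_facts Ti_pos by simp
  show False
  proof (cases "0 < flux Ti (residual t)")
    case True
    have "Ti < U t"
    proof (rule orbit_strictly_above_constant[OF \<beta> U, where a = 0])
      show "0 < flux Ti (residual y)" if "0 < y" "y < t" for y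
        using True flux_mono[OF residual_antimono[of y t], of Ti] that t by linarith
    qed (use t Ti_le U in \<open>auto simp: orbit_def\<close>)
    then show False using neg by simp
  next
    case False
    have "U 1 \<le> Ti"
    proof (rule orbit_below_constant[OF \<beta> U, where a = t and b = 1])
      show "flux Ti (residual y) \<le> 0" if "t < y" "y < 1" for y
        using False flux_mono[OF residual_antimono[of t y], of Ti] that t by linarith
    qed (use t Ti_le neg in auto)
    then show False using end1 roots(5) by linarith
  qed
qed

text \<open>
  Suppose the flux is not positive at some time. If the orbit is then below \<open>T0 c\<close>, its current
  value is an upper barrier for the rest of the zone, since \<open>flux\<close> decreases with \<open>residual\<close>;
  if it has reached \<open>T0 c\<close>, the constant \<open>T0 c\<close> is a strict lower barrier. Either way the orbit
  misses \<open>T0 c\<close> at the end.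
\<close>

lemma critical_orbit_flux_pos:
  assumes \<beta>: "0 < \<beta>" and U: "orbit \<beta> U" and end1: "U 1 = T0 c" and t: "0 < t" "t < 1"
  shows "0 < flux (U t) (residual t)"
proof (rule ccontr)
  assume neg: "\<not> 0 < flux (U t) (residual t)"
  have zt: "0 < q0 * residual t" using residual_pos t q0_pos by simp
  have bounds: "Ti < U t" "U t \<le> 2 * c"
    using orbit_gt_Ti[OF \<beta> U] orbit_le[OF \<beta> U] end1 t by auto
  show False
  proof (cases "U t < T0 c")
    case True
    have "U 1 \<le> U t"
    proof (rule orbit_below_constant[OF \<beta> U, where a = t and b = 1])
      show "flux (U t) (residual y) \<le> 0" if "t < y" "y < 1" for y
        using neg flux_mono[OF residual_antimono[of t y], of "U t"] that t by linarith
    qed (use t bounds in auto)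
    then show False using True end1 by simp
  next
    case False
    have "T0 c < U 1"
    proof (rule orbit_strictly_above_constant[OF \<beta> U, where a = t])
      show "0 < flux (T0 c) (residual y)" if "t < y" "y < 1" for y
        using residual_pos[of y] that q0_pos by (simp add: flux_factor)
    qed (use t False roots in auto)
    then show False using end1 by simp
  qed
qed

text \<open>
  Since its slope is positive, the critical orbit for \<open>\<beta>'\<close> is a strict subsolution of the equation
  with the smaller viscosity \<open>\<beta>\<close>.
\<close>

lemma critical_orbit_strictly_below:
  assumes \<beta>: "0 < \<beta>" "\<beta> < \<beta>'" and U: "orbit \<beta> U" and U': "orbit \<beta>' U'" and end1: "U' 1 = T0 c"
  shows "T0 c < U 1"
proof -
  obtain L where L: "\<And>y x x'. 0 \<le> y \<Longrightarrow> y \<le> 1 \<Longrightarrow>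
      \<bar>slope y (clamp x) / \<beta> - slope y (clamp x') / \<beta>\<bar> \<le> L * \<bar>x - x'\<bar>"
    using slope_lipschitz[OF \<beta>(1)] by blast
  have less: "slope y (clamp (U' y)) / \<beta>' < slope y (clamp (U' y)) / \<beta>" if y: "0 < y" "y < 1" for y
  proof -
    have "Ti < U' y" "U' y \<le> 2 * c"
      using orbit_gt_Ti[OF _ U', of y] orbit_le[OF _ U', of y] \<beta> end1 y by auto
    then have "0 < slope y (clamp (U' y))"
      using critical_orbit_flux_pos[OF _ U' end1 y] \<beta> by (simp add: clamp_id slope_sign)
    then show ?thesis using \<beta> by (intro divide_strict_left_mono) auto
  qed
  have "U' 1 < U 1"
  proof (rule subsolution_less_supersolution[where g = "\<lambda>y x. slope y (clamp x) / \<beta>" and L = L and a = 0 and b = 1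
        and v' = "\<lambda>y. slope y (clamp (U' y)) / \<beta>'" and w' = "\<lambda>y. slope y (clamp (U y)) / \<beta>"])
  qed (use U U' L less in \<open>auto simp: orbit_def intro: less_imp_le\<close>)
  then show ?thesis using end1 by simp
qed

lemma critical_viscosity_unique:
  assumes "0 < \<beta>" "orbit \<beta> U" "U 1 = T0 c" and "0 < \<beta>'" "orbit \<beta>' U'" "U' 1 = T0 c"
  shows "\<beta> = \<beta>'"
  using critical_orbit_strictly_below[of \<beta> \<beta>' U U'] critical_orbit_strictly_below[of \<beta>' \<beta> U' U] assms
  by (cases \<beta> \<beta>' rule: linorder_cases) auto

lemma orbit_exists:
  assumes \<beta>: "0 < \<beta>"
  shows "\<exists>U. orbit \<beta> U"
proof -
  obtain L where L: "\<And>y x x'. 0 \<le> y \<Longrightarrow> y \<le> 1 \<Longrightarrow>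
      \<bar>slope y (clamp x) / \<beta> - slope y (clamp x') / \<beta>\<bar> \<le> L * \<bar>x - x'\<bar>"
    using slope_lipschitz[OF \<beta>] by blast
  let ?D = "{0..1} \<times> UNIV :: (real \<times> real) set"
  have "continuous_on UNIV clamp"
    unfolding clamp_def by (intro continuous_intros)
  then have cont_clamp: "continuous_on ?D (\<lambda>p. clamp (snd p))"
    by (rule continuous_on_compose2) (auto intro!: continuous_intros)
  have cont_residual: "continuous_on ?D (\<lambda>p. residual (fst p))"
    by (rule continuous_on_compose2[OF continuous_residual]) (auto intro!: continuous_intros)
  have "continuous_on ?D (\<lambda>p. delay (clamp (snd p)))"
    by (rule continuous_on_compose2[OF continuous_delay cont_clamp]) (use clamp_bounds in auto)
  then have "continuous_on ?D (\<lambda>(y, x). slope y (clamp x) / \<beta>)"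
    unfolding case_prod_unfold slope_def flux_def
    using \<beta> by (intro continuous_intros cont_clamp cont_residual) auto
  then obtain U where "U 0 = Ti" "continuous_on {0..1} U"
      "\<And>y. 0 < y \<Longrightarrow> y < 1 \<Longrightarrow> (U has_real_derivative slope y (clamp (U y)) / \<beta>) (at y)"
    by (rule ivp_solution_exists[OF _ L]) auto
  then show ?thesis by (auto simp: orbit_def)
qed

text \<open>
  The flux at \<open>(Ti, residual 0)\<close> is positive, and stays bounded below by some \<open>\<delta>\<close> for
  temperatures in \<open>[Ti, T0 c]\<close> and \<open>y \<le> y1\<close>. For small viscosity the straight line from \<open>Ti\<close> at
  \<open>0\<close> to \<open>T0 c\<close> at \<open>y1\<close> is thus a subsolution. Afterwards the constant \<open>T0 c\<close> is a lower barrier.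
\<close>

lemma small_viscosity_overshoots:
  assumes "0 < \<beta>"
  obtains \<beta>' where "0 < \<beta>'" "\<beta>' \<le> \<beta>" "\<And>U. orbit \<beta>' U \<Longrightarrow> T0 c \<le> U 1"
proof -
  obtain r where r: "0 < r" "\<And>x. r \<le> delay (clamp x)" using slope_bounds by metis
  have pos0: "0 < flux Ti (residual 0)"
  proof -
    have "0 < Ti * (2 * c - Ti)" using Ti_pos c_facts by (intro mult_pos_pos) auto
    then show ?thesis by (simp add: flux_def power2_eq_square algebra_simps)
  qed
  obtain y1 where y1: "0 < y1" "y1 < 1" "0 < flux Ti (residual y1)"
  proof -
    have "continuous_on {..1} (\<lambda>y. flux Ti (residual y))"
      unfolding flux_def by (intro continuous_intros continuous_residual)
    then have "isCont (\<lambda>y. flux Ti (residual y)) 0"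
      using continuous_on_interior[of "{..1}" _ "0::real"] by simp
    then have "eventually (\<lambda>y. 0 < flux Ti (residual y)) (at 0)"
      using pos0 order_tendstoD(1) unfolding isCont_def by blast
    then obtain e where "0 < e" "\<And>y. y \<noteq> 0 \<Longrightarrow> \<bar>y\<bar> < e \<Longrightarrow> 0 < flux Ti (residual y)"
      unfolding eventually_at by (auto simp: dist_real_def)
    then show ?thesis by (intro that[of "min (e / 2) (1 / 2)"]) auto
  qed
  \<comment> \<open>The flux is concave in the temperature: between \<open>T1\<close> and \<open>T0 c\<close> its burnt part is
    nonnegative, and below \<open>T1 \<le> c\<close> it increases from its value at \<open>Ti\<close>.\<close>
  define \<delta> where "\<delta> = min (q0 * residual y1) (flux Ti (residual y1))"
  have \<delta>: "0 < \<delta>" using y1 q0_pos residual_pos by (simp add: \<delta>_def)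
  have flux_ge: "\<delta> \<le> flux T (residual y)" if "Ti \<le> T" "T \<le> T0 c" "y \<le> y1" for T y
  proof -
    have "\<delta> \<le> flux T (residual y1)"
    proof (cases "T1 \<le> T")
      case True
      then have "0 \<le> (T0 c - T) * (T - T1)" using that by simp
      then show ?thesis by (simp add: flux_factor \<delta>_def)
    next
      case False
      have "0 \<le> (T - Ti) * (c - (T + Ti) / 2)" using that False roots by simp
      then have "flux Ti (residual y1) \<le> flux T (residual y1)"
        by (simp add: flux_def field_simps power2_eq_square)
      then show ?thesis by (simp add: \<delta>_def)
    qed
    also have "\<dots> \<le> flux T (residual y)" using residual_antimono that y1 by (intro flux_mono) auto
    finally show ?thesis .
  qed
  define \<beta>' where "\<beta>' = min \<beta> (\<delta> * r * y1 / (T0 c - Ti))"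
  have \<beta>': "0 < \<beta>'" "\<beta>' \<le> \<beta>" using assms \<delta> r y1 roots by (auto simp: \<beta>'_def)
  show thesis
  proof (rule that[OF \<beta>'])
    fix U assume U: "orbit \<beta>' U"
    obtain L where L: "\<And>y x x'. 0 \<le> y \<Longrightarrow> y \<le> 1 \<Longrightarrow>
        \<bar>slope y (clamp x) / \<beta>' - slope y (clamp x') / \<beta>'\<bar> \<le> L * \<bar>x - x'\<bar>"
      using slope_lipschitz[OF \<beta>'(1)] by blast
    define v where "v y = Ti + (T0 c - Ti) / y1 * y" for y
    have v: "Ti \<le> v y" "v y \<le> T0 c" if "0 \<le> y" "y \<le> y1" for y
    proof -
      have "0 \<le> (T0 c - Ti) * (y / y1)" using that y1 roots by simp
      moreover have "(T0 c - Ti) * (y / y1) \<le> (T0 c - Ti) * 1"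
        using that y1 roots by (intro mult_left_mono) auto
      ultimately
      show "Ti \<le> v y" "v y \<le> T0 c" by (auto simp: v_def)
    qed
    have "v y1 \<le> U y1"
    proof (rule subsolution_le_supersolution[where a = 0 and b = y1 and v = v and w = U
          and g = "\<lambda>y x. slope y (clamp x) / \<beta>'" and L = L and v' = "\<lambda>_. (T0 c - Ti) / y1"])
      show "continuous_on {0..y1} U"
        using U y1 by (auto simp: orbit_def intro: continuous_on_subset)
      show "continuous_on {0..y1} v" unfolding v_def by (intro continuous_intros)
      show "(v has_real_derivative (T0 c - Ti) / y1) (at y)" for y
        unfolding v_def using y1 by (auto intro!: derivative_eq_intros)
      fix y assume y: "0 < y" "y < y1"
      have cv: "clamp (v y) = v y" using v[of y] y roots by (intro clamp_id) auto
      have "\<delta> * r \<le> slope y (v y)"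
        unfolding slope_def using r(2)[of "v y"] r(1) \<delta> flux_ge[OF v, of y y] y cv
        by (intro mult_mono) auto
      moreover have "(T0 c - Ti) / y1 * \<beta>' \<le> \<delta> * r"
      proof -
        have "\<beta>' \<le> \<delta> * r * y1 / (T0 c - Ti)" by (simp add: \<beta>'_def)
        then show ?thesis using roots y1 by (simp add: field_simps)
      qed
      ultimately have "(T0 c - Ti) / y1 * \<beta>' \<le> slope y (v y)" by linarith
      then show "(T0 c - Ti) / y1 \<le> slope y (clamp (v y)) / \<beta>'"
        using \<beta>' cv by (simp add: pos_le_divide_eq)
    qed (use U L y1 in \<open>auto simp: orbit_def v_def\<close>)
    then have "T0 c \<le> U y1" using y1 by (simp add: v_def)
    then show "T0 c \<le> U 1"
      by (rule orbit_above_constant[OF \<beta>'(1) U, where b = 1, rotated -2])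
         (use y1 roots q0_pos residual_pos in \<open>auto simp: flux_factor less_imp_le\<close>)
  qed
qed

text \<open>
  In the variable \<open>p = 1/\<beta>\<close> the end value of the orbit is Lipschitz on compact intervals, so the
  intermediate value theorem applies between \<open>\<beta>\<close> and a smaller viscosity that overshoots.
\<close>

lemma shooting:
  assumes \<beta>: "0 < \<beta>"
  shows "(\<exists>U. orbit \<beta> U \<and> T0 c \<le> U 1) \<or>
    (\<exists>\<beta>' U. 0 < \<beta>' \<and> \<beta>' \<le> \<beta> \<and> orbit \<beta>' U \<and> U 1 = T0 c)"
proof -
  obtain u where u: "\<And>b. 0 < b \<Longrightarrow> orbit b (u b)" using orbit_exists by metis
  obtain b where b: "0 < b" "b \<le> \<beta>" "T0 c \<le> u b 1" using small_viscosity_overshoots[OF \<beta>] u by metis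
  obtain L M where LM: "0 \<le> L"
      "\<And>y x x'. 0 \<le> y \<Longrightarrow> y \<le> 1 \<Longrightarrow> \<bar>slope y (clamp x) - slope y (clamp x')\<bar> \<le> L * \<bar>x - x'\<bar>"
      "\<And>y x. 0 \<le> y \<Longrightarrow> y \<le> 1 \<Longrightarrow> \<bar>slope y (clamp x)\<bar> \<le> M"
    using slope_bounds by metis
  define C where "C = exp (1 / b * L + 1/2) * M"
  have dep: "\<bar>u (1 / p) 1 - u (1 / q) 1\<bar> \<le> C * \<bar>p - q\<bar>" if "0 < p" "p \<le> 1 / b" "0 < q" for p q
    unfolding C_def
    by (rule ivp_parameter_dependence[where g = "\<lambda>y x. slope y (clamp x)"])
       (use that LM u[of "1 / p"] u[of "1 / q"] in \<open>auto simp: orbit_def mult.commute\<close>)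
  have M: "0 \<le> M" using LM(3)[of 0 0] by simp
  have "(C)-lipschitz_on {1 / \<beta>..1 / b} (\<lambda>p. u (1 / p) 1)"
  proof (rule lipschitz_onI)
    fix p q assume "p \<in> {1 / \<beta>..1 / b}" "q \<in> {1 / \<beta>..1 / b}"
    moreover have "0 < 1 / \<beta>" using \<beta> by simp
    ultimately have "0 < p" "p \<le> 1 / b" "0 < q" unfolding atLeastAtMost_iff by linarith+
    from dep[OF this] show "dist (u (1 / p) 1) (u (1 / q) 1) \<le> C * dist p q"
      by (simp add: dist_real_def)
  qed (use M in \<open>simp add: C_def\<close>)
  then have cont: "continuous_on {1 / \<beta>..1 / b} (\<lambda>p. u (1 / p) 1)"
    by (rule lipschitz_on_continuous_on)
  show ?thesis
  proof (cases "T0 c \<le> u \<beta> 1")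
    case True
    then show ?thesis using u[OF \<beta>] by blast
  next
    case False
    have "1 / \<beta> \<le> 1 / b" using b \<beta> by (simp add: field_simps)
    then obtain p where p: "1 / \<beta> \<le> p" "p \<le> 1 / b" "u (1 / p) 1 = T0 c"
      using IVT'[OF _ _ _ cont, of "T0 c"] False b by auto
    have "0 < p" using p(1) \<beta> by (metis less_le_trans zero_less_divide_1_iff)
    then have "0 < 1 / p" "1 / p \<le> \<beta>" using p \<beta> by (auto simp: field_simps)
    then show ?thesis using u[of "1 / p"] p by blast
  qed
qed

section \<open>Waves and orbits\<close>

text \<open>
  For \<open>Z = 1\<close> the equation is of Bernoulli type with equilibria \<open>0\<close> and \<open>2c\<close>, hence linear in
  \<open>1/T\<close>.
\<close>

lemma unburnt_tail:
  assumes \<beta>: "0 < \<beta>"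
  obtains S where "S 0 = Ti" "\<And>\<xi>. 0 < \<xi> \<Longrightarrow> S \<xi> < Ti" "(S \<longlongrightarrow> 0) at_top"
    "\<And>\<xi>. 0 \<le> \<xi> \<Longrightarrow> (S has_real_derivative - flux (S \<xi>) 1 / \<beta>) (at \<xi>)"
proof -
  define k where "k = 1 / Ti - 1 / (2 * c)"
  have k: "0 < k" using Ti_pos c_facts by (simp add: k_def field_simps)
  define v where "v \<xi> = 1 / (2 * c) + k * exp (c / \<beta> * \<xi>)" for \<xi>
  have v_pos: "0 < v \<xi>" for \<xi> using k c_facts by (simp add: v_def add_pos_pos)
  have v0: "v 0 = 1 / Ti" by (simp add: v_def k_def)
  have der_v: "(v has_real_derivative c / \<beta> * (v \<xi> - 1 / (2 * c))) (at \<xi>)" for \<xi>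
    unfolding v_def using \<beta> by (auto intro!: derivative_eq_intros)
  show thesis
  proof (rule that[of "\<lambda>\<xi>. 1 / v \<xi>"])
    show "1 / v 0 = Ti" by (simp add: v0)
    show "1 / v \<xi> < Ti" if "0 < \<xi>" for \<xi>
    proof -
      have "v 0 < v \<xi>" using that k \<beta> c_facts by (simp add: v_def)
      then show ?thesis using v_pos[of \<xi>] Ti_pos unfolding v0 by (simp add: field_simps)
    qed
    have "filterlim (\<lambda>\<xi>. c / \<beta> * \<xi>) at_top at_top"
      using \<beta> c_facts by (intro filterlim_tendsto_pos_mult_at_top[OF tendsto_const] filterlim_ident) auto
    then have "filterlim (\<lambda>\<xi>. exp (c / \<beta> * \<xi>)) at_top at_top"
      by (rule filterlim_compose[OF exp_at_top])
    then have "filterlim (\<lambda>\<xi>. k * exp (c / \<beta> * \<xi>)) at_top at_top"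
      by (rule filterlim_tendsto_pos_mult_at_top[OF tendsto_const k])
    then have "filterlim v at_top at_top"
      unfolding v_def by (intro filterlim_tendsto_add_at_top[OF tendsto_const])
    then show "((\<lambda>\<xi>. 1 / v \<xi>) \<longlongrightarrow> 0) at_top"
      by (intro tendsto_divide_0[OF tendsto_const] filterlim_at_top_imp_at_infinity)
    show "((\<lambda>\<xi>. 1 / v \<xi>) has_real_derivative - flux (1 / v \<xi>) 1 / \<beta>) (at \<xi>)" for \<xi>
      using v_pos[of \<xi>] \<beta> c_facts
      by (auto intro!: derivative_eq_intros der_v simp: flux_def field_simps power2_eq_square)
  qed
qed

text \<open>
  For \<open>Z = 0\<close> the substitution \<open>v = 1 / (T - T0 c)\<close> makes the equation linear; \<open>v\<close> grows without
  bound as \<open>\<xi> \<rightarrow> -\<infinity>\<close>. The equilibrium \<open>T0 c\<close> itself has to be treated separately.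
\<close>

lemma burnt_tail:
  assumes \<beta>: "0 < \<beta>" and \<tau>: "T0 c \<le> \<tau>"
  obtains S where "S a = \<tau>" "\<And>\<xi>. \<xi> \<le> a \<Longrightarrow> T0 c \<le> S \<xi>" "(S \<longlongrightarrow> T0 c) at_bot"
    "\<And>\<xi>. \<xi> \<le> a \<Longrightarrow> (S has_real_derivative - flux (S \<xi>) 0 / \<beta>) (at \<xi>)"
    "\<tau> = T0 c \<Longrightarrow> \<forall>\<xi>\<le>a. S \<xi> = T0 c"
proof (cases "\<tau> = T0 c")
  case True
  then show thesis
    by (intro that[of "\<lambda>_. T0 c"]) (auto simp: flux_factor)
next
  case False
  define w where "w = \<tau> - T0 c"
  define d where "d = T0 c - T1"
  have w: "0 < w" using \<tau> False by (simp add: w_def)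
  have d: "0 \<le> d" using roots by (simp add: d_def)
  obtain h where h: "h 0 = 0" "\<And>x. (h has_real_derivative 1 + d * h x) (at x)" "\<And>x. 0 \<le> x \<Longrightarrow> x \<le> h x"
    using linear_growth_solution[OF d] by blast
  define v where "v \<xi> = 1 / w + (1 + d / w) * h ((a - \<xi>) / (2 * \<beta>))" for \<xi>
  have v_ge: "1 / w + (a - \<xi>) / (2 * \<beta>) \<le> v \<xi>" if "\<xi> \<le> a" for \<xi>
  proof -
    have "1 * ((a - \<xi>) / (2 * \<beta>)) \<le> (1 + d / w) * h ((a - \<xi>) / (2 * \<beta>))"
      using d w that \<beta> by (intro mult_mono h) auto
    then show ?thesis by (simp add: v_def)
  qed
  have v_pos: "0 < v \<xi>" if "\<xi> \<le> a" for \<xi>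
  proof -
    have "0 < 1 / w" "0 \<le> (a - \<xi>) / (2 * \<beta>)" using w that \<beta> by auto
    then show ?thesis using v_ge[OF that] by linarith
  qed
  have der_v: "(v has_real_derivative - (1 + d * v \<xi>) / (2 * \<beta>)) (at \<xi>)" for \<xi>
  proof -
    have "((\<lambda>\<xi>. h ((a - \<xi>) / (2 * \<beta>))) has_real_derivative
        (1 + d * h ((a - \<xi>) / (2 * \<beta>))) * (- 1 / (2 * \<beta>))) (at \<xi>)"
      by (rule DERIV_chain2[OF h(2)]) (use \<beta> in \<open>auto intro!: derivative_eq_intros\<close>)
    then have "(v has_real_derivative
        (1 + d / w) * ((1 + d * h ((a - \<xi>) / (2 * \<beta>))) * (- 1 / (2 * \<beta>)))) (at \<xi>)"
      unfolding v_def by (auto intro!: derivative_eq_intros)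
    moreover have "(1 + d / w) * ((1 + d * h ((a - \<xi>) / (2 * \<beta>))) * (- 1 / (2 * \<beta>)))
        = - (1 + d * v \<xi>) / (2 * \<beta>)"
      using \<beta> w by (simp add: v_def field_simps)
    ultimately show ?thesis by simp
  qed
  show thesis
  proof (rule that[of "\<lambda>\<xi>. T0 c + 1 / v \<xi>"])
    show "T0 c + 1 / v a = \<tau>" by (simp add: v_def h w_def)
    show "T0 c \<le> T0 c + 1 / v \<xi>" if "\<xi> \<le> a" for \<xi> using v_pos[OF that] by simp
    have "filterlim (\<lambda>\<xi>. 1 / w + (a - \<xi>) / (2 * \<beta>)) at_top at_bot"
    proof -
      have "filterlim (\<lambda>\<xi>. a - \<xi>) at_top at_bot"
        using filterlim_tendsto_add_at_top[OF tendsto_const filterlim_uminus_at_top_at_bot, of a] by simp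
      then have "filterlim (\<lambda>\<xi>. (a - \<xi>) * (1 / (2 * \<beta>))) at_top at_bot"
        using \<beta> by (intro filterlim_at_top_mult_tendsto_pos[OF tendsto_const]) auto
      then show ?thesis by (intro filterlim_tendsto_add_at_top[OF tendsto_const]) simp
    qed
    then have "filterlim v at_top at_bot"
      by (rule filterlim_at_top_mono) (use v_ge in \<open>auto simp: eventually_at_bot_linorder\<close>)
    then have "((\<lambda>\<xi>. 1 / v \<xi>) \<longlongrightarrow> 0) at_bot"
      by (intro tendsto_divide_0[OF tendsto_const] filterlim_at_top_imp_at_infinity)
    then show "((\<lambda>\<xi>. T0 c + 1 / v \<xi>) \<longlongrightarrow> T0 c) at_bot"
      using tendsto_add[OF tendsto_const] by fastforce
    fix \<xi> assume \<xi>: "\<xi> \<le> a"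
    have "((\<lambda>\<xi>. T0 c + 1 / v \<xi>) has_real_derivative (1 + d * v \<xi>) / (2 * \<beta>) / (v \<xi>)\<^sup>2) (at \<xi>)"
      using v_pos[OF \<xi>] \<beta> by (auto intro!: derivative_eq_intros der_v simp: power2_eq_square field_simps)
    moreover have "(1 + d * v \<xi>) / (2 * \<beta>) / (v \<xi>)\<^sup>2 = - flux (T0 c + 1 / v \<xi>) 0 / \<beta>"
      using v_pos[OF \<xi>] \<beta> by (simp add: flux_factor d_def field_simps power2_eq_square)
    ultimately show "((\<lambda>\<xi>. T0 c + 1 / v \<xi>) has_real_derivative - flux (T0 c + 1 / v \<xi>) 0 / \<beta>) (at \<xi>)"
      by simp
  qed (use False in simp)
qed

text \<open>
  The position of progress \<open>y\<close> is \<open>- pos y\<close> with \<open>pos y\<close> the integral of \<open>delay\<close> along the orbit; the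
  profile in the reaction zone is the orbit composed with the inverse of \<open>pos\<close>. At \<open>\<xi> = 0\<close> and
  \<open>\<xi> = -l\<close> both \<open>T\<close> and \<open>Z\<close> match the outer solutions, and as \<open>T\<close> satisfies \<open>\<beta> T\<^sub>\<xi> = - flux T Z\<close>
  on each side, it is continuously differentiable there.
\<close>

lemma wave_of_orbit:
  assumes \<beta>: "0 < \<beta>" and U: "orbit \<beta> U" and end1: "T0 c \<le> U 1"
  obtains l T Z where "wave_profile \<beta> c l T Z" "U 1 = T0 c \<Longrightarrow> \<forall>\<xi>\<le>- l. T \<xi> = T0 c"
proof -
  have U_bounds: "Ti \<le> U y" "U y \<le> 2 * c" if "0 \<le> y" "y \<le> 1" for y
    using orbit_gt_Ti[OF \<beta> U end1, of y] orbit_le[OF \<beta> U that] orbitD(2)[OF U] that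
    by (cases "y = 0"; auto)+
  define pos where "pos y = integral {0..y} (\<lambda>s. delay (U s))" for y
  have cont_delay: "continuous_on {0..1} (\<lambda>s. delay (U s))"
    by (rule continuous_on_compose2[OF continuous_delay orbitD(1)[OF U]]) (use U_bounds in auto)
  have der_pos_within: "(pos has_real_derivative delay (U y)) (at y within {0..1})" if "0 \<le> y" "y \<le> 1" for y
    unfolding pos_def[abs_def] by (rule integral_has_real_derivative[OF cont_delay]) (use that in auto)
  then have cont_pos: "continuous_on {0..1} pos"
    by (meson DERIV_continuous atLeastAtMost_iff continuous_on_eq_continuous_within)
  have der_pos: "(pos has_real_derivative delay (U y)) (at y)" if "0 < y" "y < 1" for y
    using der_pos_within[of y] that by (simp add: at_within_Icc_at)
  define l where "l = pos 1"
  have pos0: "pos 0 = 0" by (simp add: pos_def)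
  have delay_U: "0 < delay (U y)" if "0 < y" "y < 1" for y
    using delay_pos[OF U_bounds(1)] that by simp
  obtain Y where "pos 0 < pos 1" "Y (pos 0) = 0" "Y (pos 1) = 1" "continuous_on {pos 0..pos 1} Y"
      "\<And>x. pos 0 < x \<Longrightarrow> x < pos 1 \<Longrightarrow> 0 < Y x \<and> Y x < 1 \<and> pos (Y x) = x"
      "\<And>x. pos 0 < x \<Longrightarrow> x < pos 1 \<Longrightarrow> (Y has_real_derivative inverse (delay (U (Y x)))) (at x)"
    by (rule increasing_inverse[OF zero_less_one cont_pos der_pos delay_U]) blast+
  then have l: "0 < l" and Y: "Y 0 = 0" "Y l = 1" "continuous_on {0..l} Y"
      "\<And>x. 0 < x \<Longrightarrow> x < l \<Longrightarrow> 0 < Y x \<and> Y x < 1"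
      "\<And>x. 0 < x \<Longrightarrow> x < l \<Longrightarrow> (Y has_real_derivative inverse (delay (U (Y x)))) (at x)"
    by (simp_all add: pos0 l_def)
  have Y_range: "Y x \<in> {0..1}" if "x \<in> {0..l}" for x
    using Y(1,2) Y(4)[of x] that by (cases "x = 0 \<or> x = l") (auto intro: less_imp_le)
  obtain Su where Su: "Su 0 = Ti" "\<And>\<xi>. 0 < \<xi> \<Longrightarrow> Su \<xi> < Ti" "(Su \<longlongrightarrow> 0) at_top"
      "\<And>\<xi>. 0 \<le> \<xi> \<Longrightarrow> (Su has_real_derivative - flux (Su \<xi>) 1 / \<beta>) (at \<xi>)"
    using unburnt_tail[OF \<beta>] by blast
  obtain Sb where Sb: "Sb (- l) = U 1" "\<And>\<xi>. \<xi> \<le> - l \<Longrightarrow> T0 c \<le> Sb \<xi>" "(Sb \<longlongrightarrow> T0 c) at_bot"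
      "\<And>\<xi>. \<xi> \<le> - l \<Longrightarrow> (Sb has_real_derivative - flux (Sb \<xi>) 0 / \<beta>) (at \<xi>)"
      "U 1 = T0 c \<Longrightarrow> \<forall>\<xi>\<le>- l. Sb \<xi> = T0 c"
    using burnt_tail[OF \<beta> end1, of "- l"] by blast
  define T where "T \<xi> = (if \<xi> \<le> - l then Sb \<xi> else if \<xi> \<le> 0 then U (Y (- \<xi>)) else Su \<xi>)" for \<xi>
  define Z where "Z \<xi> = (if \<xi> \<le> - l then 0 else if \<xi> \<le> 0 then residual (Y (- \<xi>)) else 1)" for \<xi>
  have cont_Y: "continuous_on {- l..0} (\<lambda>\<xi>. Y (- \<xi>))"
    by (rule continuous_on_compose2[OF Y(3)]) (auto intro!: continuous_intros)
  have cont_T: "continuous_on UNIV T"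
    unfolding T_def
  proof (rule continuous_on_three_pieces)
    show "continuous_on {- l..0} (\<lambda>\<xi>. U (Y (- \<xi>)))"
      by (rule continuous_on_compose2[OF orbitD(1)[OF U] cont_Y]) (use Y_range in force)
    show "continuous_on {..- l} Sb" "continuous_on {0..} Su"
      using Su(4) Sb(4) by (auto intro!: continuous_at_imp_continuous_on DERIV_isCont)
  qed (use l Su Sb Y orbitD(2)[OF U] in auto)
  have cont_Z: "continuous_on UNIV Z"
    unfolding Z_def
  proof (rule continuous_on_three_pieces)
    show "continuous_on {- l..0} (\<lambda>\<xi>. residual (Y (- \<xi>)))"
      by (rule continuous_on_compose2[OF continuous_residual cont_Y]) (use Y_range in force)
  qed (use l Y in auto)
  have der_Y: "((\<lambda>\<xi>. Y (- \<xi>)) has_real_derivative - inverse (delay (U (Y (- \<xi>))))) (at \<xi>)"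
    if "- l < \<xi>" "\<xi> < 0" for \<xi>
  proof -
    have "(Y has_real_derivative inverse (delay (U (Y (- \<xi>))))) (at (- \<xi>))" using Y(5) that by simp
    moreover have "(uminus has_real_derivative - 1) (at \<xi>)" by (auto intro!: derivative_eq_intros)
    ultimately show ?thesis using DERIV_chain2[of Y _ uminus \<xi> "- 1" UNIV] by simp
  qed
  have mid: "0 < Y (- \<xi>)" "Y (- \<xi>) < 1" "0 < delay (U (Y (- \<xi>)))"
      "clamp (U (Y (- \<xi>))) = U (Y (- \<xi>))" "T \<xi> = U (Y (- \<xi>))" "Z \<xi> = residual (Y (- \<xi>))"
    if "- l < \<xi>" "\<xi> < 0" for \<xi>
    using Y(4)[of "- \<xi>"] U_bounds[of "Y (- \<xi>)"] delay_pos that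
    by (auto simp: clamp_id T_def Z_def)
  have der_T: "(T has_real_derivative - flux (T \<xi>) (Z \<xi>) / \<beta>) (at \<xi>)" if "\<xi> \<notin> {- l, 0}" for \<xi>
  proof -
    consider "\<xi> < - l" | "- l < \<xi>" "\<xi> < 0" | "0 < \<xi>" using \<open>\<xi> \<notin> {- l, 0}\<close> by force
    then show ?thesis
    proof cases
      case 1
      then show ?thesis
        using has_field_derivative_transform_within_open[OF Sb(4)[of \<xi>], of "{..<- l}" T]
        by (auto simp: T_def Z_def)
    next
      case 2
      have "((\<lambda>\<xi>. U (Y (- \<xi>))) has_real_derivative
          slope (Y (- \<xi>)) (clamp (U (Y (- \<xi>)))) / \<beta> * - inverse (delay (U (Y (- \<xi>))))) (at \<xi>)"
        by (rule DERIV_chain2[OF orbitD(3)[OF U] der_Y]) (use mid 2 in auto)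
      also have "slope (Y (- \<xi>)) (clamp (U (Y (- \<xi>)))) / \<beta> * - inverse (delay (U (Y (- \<xi>))))
          = - flux (T \<xi>) (Z \<xi>) / \<beta>"
        using mid[OF 2] by (simp add: slope_def)
      finally show ?thesis
        by (rule has_field_derivative_transform_within_open[of _ _ _ "{- l<..<0}"])
           (use 2 mid in auto)
    next
      case 3
      then show ?thesis
        using has_field_derivative_transform_within_open[OF Su(4)[of \<xi>], of "{0<..}" T] l
        by (auto simp: T_def Z_def)
    qed
  qed
  have cont_T': "continuous_on UNIV (\<lambda>\<xi>. - flux (T \<xi>) (Z \<xi>) / \<beta>)"
    unfolding flux_def using \<beta> by (intro continuous_intros cont_T cont_Z) auto
  have der_T_all: "(T has_real_derivative - flux (T \<xi>) (Z \<xi>) / \<beta>) (at \<xi>)" for \<xi>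
    using derivative_across_exceptional_points[OF _ cont_T cont_T' der_T, of "{- l, 0}" \<xi>] by simp
  have eqn: "\<beta> * deriv T \<xi> = - c * T \<xi> + (T \<xi>)\<^sup>2 / 2 + q0 * (1 - Z \<xi>)" for \<xi>
    using DERIV_imp_deriv[OF der_T_all, of \<xi>] \<beta> by (simp add: flux_def field_simps)
  have der_Z: "(Z has_real_derivative K * \<phi> (T \<xi>) * Z \<xi> powr \<alpha>) (at \<xi>)" if \<xi>: "- l < \<xi>" "\<xi> < 0" for \<xi>
  proof -
    have "(residual has_real_derivative - (1 / (1 - \<alpha>) * (1 - y) powr (1 / (1 - \<alpha>) - 1))) (at y)" if "y < 1" for y
      unfolding residual_def[abs_def] using that by (auto intro!: derivative_eq_intros)
    from DERIV_chain2[OF this der_Y[OF \<xi>]] mid[OF \<xi>]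
    have "((\<lambda>\<xi>. residual (Y (- \<xi>))) has_real_derivative
        1 / (1 - \<alpha>) * (1 - Y (- \<xi>)) powr (1 / (1 - \<alpha>) - 1) * inverse (delay (U (Y (- \<xi>))))) (at \<xi>)"
      by simp
    also have "(1 - Y (- \<xi>)) powr (1 / (1 - \<alpha>) - 1) = Z \<xi> powr \<alpha>"
    proof -
      have "1 / (1 - \<alpha>) - 1 = 1 / (1 - \<alpha>) * \<alpha>" using \<alpha>_less_1 by (simp add: field_simps)
      then show ?thesis using mid[OF \<xi>] by (simp add: residual_def powr_powr)
    qed
    also have "1 / (1 - \<alpha>) * Z \<xi> powr \<alpha> * inverse (delay (U (Y (- \<xi>)))) = K * \<phi> (T \<xi>) * Z \<xi> powr \<alpha>"
      using mid[OF \<xi>] \<alpha>_less_1 by (simp add: delay_def)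
    finally show ?thesis
      by (rule has_field_derivative_transform_within_open[of _ _ _ "{- l<..<0}"])
         (use \<xi> mid in auto)
  qed
  show thesis
  proof (rule that[of l T Z])
    show "\<forall>\<xi>\<le>- l. T \<xi> = T0 c" if "U 1 = T0 c" using Sb(5)[OF that] by (simp add: T_def)
    have "T C1_differentiable_on UNIV"
      unfolding C1_differentiable_on_def
      using der_T_all cont_T' unfolding has_real_derivative_iff_has_vector_derivative
      by (intro exI[of _ "\<lambda>\<xi>. - flux (T \<xi>) (Z \<xi>) / \<beta>"]) simp
    moreover have "T 0 = Ti" "Z 0 = 1" "Z (- l) = 0"
      using l Y orbitD(2)[OF U] by (auto simp: T_def Z_def)
    moreover have "Ti < T \<xi>" if "\<xi> < 0" for \<xi>
      using that Sb(2)[of \<xi>] roots(5) orbit_gt_Ti[OF \<beta> U end1, of "Y (- \<xi>)"] mid[of \<xi>]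
      by (cases "\<xi> \<le> - l") (auto simp: T_def)
    moreover have "T \<xi> < Ti" "Z \<xi> = 1" if "0 < \<xi>" for \<xi> using that Su l by (auto simp: T_def Z_def)
    moreover have "Z \<xi> = 0" if "\<xi> < - l" for \<xi> using that by (simp add: Z_def)
    moreover have "0 < Z \<xi>" if "- l < \<xi>" "\<xi> < 0" for \<xi> using mid[OF that] residual_pos by simp
    moreover have "(T \<longlongrightarrow> 0) at_top"
      by (rule Lim_transform_eventually[OF Su(3)])
         (use l in \<open>auto simp: T_def eventually_at_top_dense intro!: exI[of _ 0]\<close>)
    moreover have "(T \<longlongrightarrow> T0 c) at_bot"
      by (rule Lim_transform_eventually[OF Sb(3)])
         (auto simp: T_def eventually_at_bot_linorder)
    ultimately show "wave_profile \<beta> c l T Z"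
      unfolding wave_profile_def using \<beta> c_ge l cont_Z der_Z eqn by auto
  qed
qed

text \<open>
  Along the zone, \<open>y = 1 - Z powr (1 - \<alpha>)\<close> has the positive derivative \<open>1 / delay T\<close> with respect to
  \<open>- \<xi>\<close>, so it can be inverted. The bound \<open>U \<le> 2c\<close> holds because the flux is nonpositive above
  \<open>2c\<close>; it shows that the cut-off does not affect \<open>U\<close>.
\<close>

lemma orbit_of_wave:
  assumes W: "wave_profile \<beta> c l T Z"
  obtains U where "orbit \<beta> U" "U 1 = T (- l)"
proof -
  have \<beta>: "0 < \<beta>" and l: "0 < l" and C1: "T C1_differentiable_on UNIV" and contZ: "continuous_on UNIV Z"
    and ends: "T 0 = Ti" "Z 0 = 1" "Z (- l) = 0" and above: "\<And>\<xi>. \<xi> < 0 \<Longrightarrow> Ti < T \<xi>"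
    and zone: "\<And>\<xi>. - l < \<xi> \<Longrightarrow> \<xi> < 0 \<Longrightarrow> 0 < Z \<xi>"
      "\<And>\<xi>. - l < \<xi> \<Longrightarrow> \<xi> < 0 \<Longrightarrow> \<beta> * deriv T \<xi> = - c * T \<xi> + (T \<xi>)\<^sup>2 / 2 + q0 * (1 - Z \<xi>)"
      "\<And>\<xi>. - l < \<xi> \<Longrightarrow> \<xi> < 0 \<Longrightarrow> (Z has_real_derivative K * \<phi> (T \<xi>) * Z \<xi> powr \<alpha>) (at \<xi>)"
    using W unfolding wave_profile_def by blast+
  have der_T: "(T has_real_derivative - flux (T \<xi>) (Z \<xi>) / \<beta>) (at \<xi>)" if "- l < \<xi>" "\<xi> < 0" for \<xi>
  proof -
    obtain D where "(T has_real_derivative D) (at \<xi>)"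
      using C1 unfolding C1_differentiable_on_def has_real_derivative_iff_has_vector_derivative by auto
    moreover from DERIV_imp_deriv[OF this] have "D = - flux (T \<xi>) (Z \<xi>) / \<beta>"
      using zone(2)[OF that] \<beta> by (simp add: flux_def field_simps)
    ultimately show ?thesis by simp
  qed
  have contT: "continuous_on UNIV T"
    using C1 by (auto intro: C1_differentiable_imp_continuous_on)
  define y where "y x = 1 - Z (- x) powr (1 - \<alpha>)" for x
  have cont_y: "continuous_on {0..l} y"
    unfolding y_def using \<alpha>_less_1 zone(1) ends
    by (intro continuous_intros continuous_on_powr' continuous_on_compose2[OF contZ])
       (force simp: le_less)+
  have der_y: "(y has_real_derivative inverse (delay (T (- x)))) (at x)" if "0 < x" "x < l" for x
  proof -
    have Z: "0 < Z (- x)" using zone(1)[of "- x"] that by simp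
    have "((\<lambda>x. Z (- x)) has_real_derivative K * \<phi> (T (- x)) * Z (- x) powr \<alpha> * - 1) (at x)"
      by (rule DERIV_chain2[OF zone(3)]) (use that in \<open>auto intro!: derivative_eq_intros\<close>)
    then have "(y has_real_derivative
        - ((1 - \<alpha>) * Z (- x) powr (1 - \<alpha> - 1) * (K * \<phi> (T (- x)) * Z (- x) powr \<alpha> * - 1))) (at x)"
      unfolding y_def using Z by (auto intro!: derivative_eq_intros)
    moreover have "Z (- x) powr (1 - \<alpha> - 1) * Z (- x) powr \<alpha> = 1"
      using Z by (simp flip: powr_add)
    ultimately show ?thesis by (simp add: delay_def ac_simps)
  qed
  have pos_y: "0 < inverse (delay (T (- x)))" if "0 < x" for x
    using delay_pos[of "T (- x)"] above[of "- x"] that by simp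
  have y_ends: "y 0 = 0" "y l = 1" using ends \<alpha>_less_1 by (auto simp: y_def)
  obtain X where X: "X 0 = 0" "X 1 = l" "continuous_on {0..1} X"
      "\<And>s. 0 < s \<Longrightarrow> s < 1 \<Longrightarrow> 0 < X s \<and> X s < l \<and> y (X s) = s"
      "\<And>s. 0 < s \<Longrightarrow> s < 1 \<Longrightarrow> (X has_real_derivative delay (T (- X s))) (at s)"
    using increasing_inverse[OF l cont_y der_y pos_y] unfolding y_ends by (metis inverse_inverse_eq)
  define U where "U s = T (- X s)" for s
  have Z_eq: "Z (- X s) = residual s" if "0 < s" "s < 1" for s
  proof -
    have "0 < Z (- X s)" using zone(1)[of "- X s"] X(4)[OF that] by simp
    moreover have "1 - s = Z (- X s) powr (1 - \<alpha>)" using X(4)[OF that] by (auto simp: y_def)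
    ultimately show ?thesis using \<alpha>_less_1 by (simp add: residual_def powr_powr)
  qed
  have der_U: "(U has_real_derivative slope s (U s) / \<beta>) (at s)" if s: "0 < s" "s < 1" for s
  proof -
    have "((\<lambda>s. - X s) has_real_derivative - delay (T (- X s))) (at s)"
      using X(5)[OF s] by (rule DERIV_minus)
    then have "(U has_real_derivative - flux (T (- X s)) (Z (- X s)) / \<beta> * - delay (T (- X s))) (at s)"
      unfolding U_def[abs_def] by (rule DERIV_chain2[OF der_T, rotated 2]) (use X(4)[OF s] in auto)
    then show ?thesis by (simp add: Z_eq[OF s] slope_def U_def)
  qed
  have contU: "continuous_on {0..1} U"
    unfolding U_def by (intro continuous_on_compose2[OF contT] continuous_intros X) auto
  have U0: "U 0 = Ti" using X ends by (simp add: U_def)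
  have above_U: "Ti < U s" if "0 < s" "s < 1" for s
    using above[of "- X s"] X(4)[OF that] by (simp add: U_def)
  have "0 \<le> 2 * c - U s" if "0 \<le> s" "s \<le> 1" for s
  proof (rule nonneg_if_deriv_ge_when_negative[where d = "\<lambda>s. 2 * c - U s" and a = 0 and b = 1
        and d' = "\<lambda>s. - (slope s (U s) / \<beta>)" and L = 0])
    fix s :: real assume s: "0 < s" "s < 1" and neg: "2 * c - U s < 0"
    show "((\<lambda>s. 2 * c - U s) has_real_derivative - (slope s (U s) / \<beta>)) (at s)"
      using der_U[OF s] by (auto intro!: derivative_eq_intros)
    have "U s * (2 * c - U s) \<le> 0"
      using neg above_U[OF s] Ti_pos by (intro mult_nonneg_nonpos) auto
    moreover have "0 \<le> q0 * (1 - residual s)" using residual_bounds[of s] s q0_pos by simp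
    ultimately have "flux (U s) (residual s) \<le> 0"
      by (simp add: flux_def field_simps power2_eq_square)
    then show "0 * (2 * c - U s) \<le> - (slope s (U s) / \<beta>)"
      using slope_sign(1)[of "U s" s] above_U[OF s] \<beta> by (simp add: divide_le_0_iff)
  qed (use that contU U0 c_facts Ti_pos in \<open>auto intro!: continuous_intros\<close>)
  then have "orbit \<beta> U"
    unfolding orbit_def using contU U0 der_U above_U by (simp add: clamp_id less_imp_le)
  then show thesis by (rule that) (simp add: U_def X)
qed

section \<open>The critical viscosity\<close>

text \<open>
  A wave that is constantly \<open>T0 c\<close> behind the reaction zone gives an orbit ending at \<open>T0 c\<close>,
  and there is only one viscosity with such an orbit.
\<close>

lemma \<beta>0_eqI:
  assumes "0 < \<beta>" "orbit \<beta> U" "U 1 = T0 c"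
  shows "\<beta>0 c = \<beta>"
  unfolding \<beta>0_def
proof (rule the_equality)
  show "0 < \<beta> \<and> (\<exists>l T Z. wave_profile \<beta> c l T Z \<and> (\<forall>\<xi>\<le>- l. T \<xi> = T0 c))"
    using wave_of_orbit[OF assms(1,2)] assms by (metis order_refl)
  fix b assume "0 < b \<and> (\<exists>l T Z. wave_profile b c l T Z \<and> (\<forall>\<xi>\<le>- l. T \<xi> = T0 c))"
  then obtain l T Z where b: "0 < b" "wave_profile b c l T Z" "T (- l) = T0 c" by auto
  obtain V where "orbit b V" "V 1 = T (- l)" using orbit_of_wave[OF b(2)] .
  then show "b = \<beta>" using critical_viscosity_unique[OF b(1)] assms b(3) by metis
qed

lemma wave_below_\<beta>0:
  assumes "0 < \<beta>" "\<beta> < \<beta>0 c"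
  shows "\<exists>T Z. reactive_wave \<beta> c T Z"
  using shooting[OF assms(1)]
proof
  assume "\<exists>U. orbit \<beta> U \<and> T0 c \<le> U 1"
  then show ?thesis
    unfolding reactive_wave_def using wave_of_orbit[OF assms(1)] by metis
next
  assume "\<exists>b U. 0 < b \<and> b \<le> \<beta> \<and> orbit b U \<and> U 1 = T0 c"
  then have "\<beta>0 c \<le> \<beta>" using \<beta>0_eqI by blast
  then show ?thesis using assms(2) by simp
qed

end

theorem corollary1p5:
  fixes q0 K \<alpha> Ti \<beta>b cb :: real and \<phi> :: "real \<Rightarrow> real"
  assumes "reactive_wave_model q0 K \<alpha> Ti \<phi>"
    and "reactive_wave_model.turning_point q0 K \<alpha> Ti \<phi> \<beta>b cb"
  shows "\<forall>\<beta>. 0 < \<beta> \<and> \<beta> < \<beta>b \<longrightarrow>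
           (\<forall>c\<ge>reactive_wave_model.c_cj q0.
              \<exists>T Z. reactive_wave_model.reactive_wave q0 K \<alpha> Ti \<phi> \<beta> c T Z)"
proof (intro allI impI)
  fix \<beta> c assume \<beta>: "0 < \<beta> \<and> \<beta> < \<beta>b" and c: "reactive_wave_model.c_cj q0 \<le> c"
  interpret reactive_wave_model q0 K \<alpha> Ti \<phi> by (fact assms(1))
  interpret wave_speed q0 K \<alpha> Ti \<phi> c by unfold_locales (fact c)
  have "\<beta>b \<le> \<beta>0 c" using assms(2) c unfolding turning_point_def by blast
  then show "\<exists>T Z. reactive_wave \<beta> c T Z" using wave_below_\<beta>0 \<beta> by simp
qed

end
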